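(* For GA1 numbers $N$ with $\Omega(N)\ge 3$, the largest prime factor satisfies $P(N)\sim \log N$ as $N\to\infty$; that is, $P(N)/\log N\to 1$ as $N\to\infty$ through GA1 numbers with $\Omega(N)\ge3$.
   Context: For an integer $n>1$ let $G(n)=\dfrac{\sigma(n)}{n\log\log n}$, where $\sigma(n)=\sum_{d\mid n}d$. A GA1 number is a composite integer $N$ such that $G(N)\ge G(N/p)$ for every prime $p$ dividing $N$. $\Omega(n)$ is the number of prime factors of $n$ counted with multiplicity, and $P(n)$ is the largest prime factor of $n>1$. *)

theory Defs
  imports Complex_Main "HOL-Computational_Algebra.Primes"
begin

definition divisor_sum :: "nat \<Rightarrow> nat" where
  "divisor_sum n = (\<Sum>d | d dvd n. d)"

(* Meaningful for n > 1 only; for n = 2 the denominator is nonzero but negative. *)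
definition gronwall :: "nat \<Rightarrow> real" where
  "gronwall n = real (divisor_sum n) / (real n * ln (ln (real n)))"

(* For composite N and a prime p dividing N, the quotient N div p is exact and greater than 1. *)
definition GA1 :: "nat \<Rightarrow> bool" where
  "GA1 N \<longleftrightarrow> N > 1 \<and> \<not> prime N \<and>
     (\<forall>p. prime p \<and> p dvd N \<longrightarrow> gronwall N \<ge> gronwall (N div p))"

definition big_omega :: "nat \<Rightarrow> nat" where
  "big_omega n = size (prime_factorization n)"

definition largest_prime_factor :: "nat \<Rightarrow> nat" where
  "largest_prime_factor n = Max (prime_factors n)"

end

theory Submission
  imports Defs "HOL-Complex_Analysis.Complex_Analysis" "HOL-Number_Theory.Prime_Powers"
    "HOL-Real_Asymp.Real_Asymp"
begin

text \<open>
  Write \<open>L = ln N\<close>. If \<open>p\<^sup>r\<close> exactly divides \<open>N\<close>, the inequality \<open>G(N) \<ge> G(N/p)\<close> turns into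
  \<open>p\<^sup>r ln p \<le> L ln L\<close>. Hence \<open>P(N) \<le> L\<close>, and all prime powers with exponent at least \<open>2\<close>
  contribute only \<open>o(L)\<close> to \<open>L\<close>, so \<open>L \<le> \<psi>(P(N)) + o(L)\<close>. The lower bound for \<open>P(N)\<close> is
  therefore the half \<open>\<psi>(x) \<le> (1 + o(1)) x\<close> of the prime number theorem.

  The latter comes from Newman's contour argument, applied to
  \<open>\<Sum>n. (\<psi>(n) - n) (n\<^sup>-\<^sup>s - (n + 1)\<^sup>-\<^sup>s) / s\<close>: its sum \<open>(- \<zeta>'/\<zeta>(s) - \<zeta>(s)) / s\<close> extends
  holomorphically to \<open>Re s \<ge> 1\<close>, so the series converges at \<open>s = 1\<close>. If \<open>\<psi>(M) > (1 + \<epsilon>) M\<close>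
  held for arbitrarily large \<open>M\<close>, the blocks from \<open>M\<close> to \<open>(1 + \<epsilon>/2) M\<close> would violate the
  Cauchy criterion.
\<close>

text \<open>Restoring a prime \<open>p\<close> of exponent \<open>r\<close> multiplies
  \<open>\<sigma>(n)/n\<close> by at most \<open>1 + p^(-r)\<close>, while \<open>ln ln\<close>
  grows by a relative amount of at least \<open>ln p / (L ln L)\<close>. GA1 says that the gain
  outweighs this growth, whence \<open>p^r ln p \<le> L ln L\<close>. The assumption
  \<open>\<Omega>(N) \<ge> 3\<close> keeps \<open>N/p \<ge> 3\<close>, so that every iterated
  logarithm is positive and denominators can be cleared. The factor
  \<open>(n^(-s) - (n+1)^(-s)) / s\<close> is the integral of \<open>x^(-s-1)\<close> over
  \<open>[n, n+1]\<close>, so the series is the Mellin integral of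
  \<open>\<psi>(x) - floor x\<close>, written with sums only. Newman's method needs its coefficients
  controlled in advance; this is the task of Chebyshev's bound \<open>\<psi>(n) \<le> 4 n\<close>,
  proved from the central binomial coefficient. Continuation to the closed half-plane needs
  \<open>\<zeta>\<close> to have no zeros on \<open>Re s = 1\<close>; for this the function
  \<open>(s - 1) \<zeta>(s)\<close>, which is free of the pole, is studied in place of
  \<open>\<zeta>\<close>.\<close>

section \<open>Newman's Tauberian theorem\<close>

text \<open>On the circle of radius \<open>R\<close> Newman's kernel vanishes at the imaginary axis, which makes up for
  the factor \<open>1 / Re w\<close> in the bounds of the Tauberian theorem.\<close>
lemma newman_kernel_norm:
  assumes "norm w = R" "R > 0"
  shows "norm (1 / w + w / of_real R ^ 2) = 2 * \<bar>Re w\<bar> / R\<^sup>2"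
proof -
  have w: "w \<noteq> 0" using assms by auto
  have "w * cnj w = of_real R ^ 2"
    using assms(1) by (metis complex_norm_square of_real_power)
  hence "1 / w = cnj w / of_real R ^ 2"
    using w assms(2) by (simp add: field_simps)
  hence "1 / w + w / of_real R ^ 2 = (w + cnj w) / of_real R ^ 2"
    by (simp add: add_divide_distrib)
  also have "w + cnj w = of_real (2 * Re w)"
    by (simp add: complex_eq_iff)
  finally show ?thesis
    using assms(2) by (simp add: norm_divide norm_power norm_mult)
qed

section \<open>Half circles and Cauchy's theorem\<close>

abbreviation right_arc :: "real \<Rightarrow> real \<Rightarrow> complex" where
  "right_arc R \<equiv> part_circlepath 0 R (-(pi/2)) (pi/2)"

abbreviation left_arc :: "real \<Rightarrow> real \<Rightarrow> complex" where
  "left_arc R \<equiv> part_circlepath 0 R (pi/2) (3*pi/2)"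

lemma right_arc_image:
  assumes "R > 0" "w \<in> path_image (right_arc R)"
  shows "norm w = R" "Re w \<ge> 0"
proof -
  from assms obtain x where x: "w = of_real R * exp (\<i> * of_real x)" "-(pi/2) \<le> x" "x \<le> pi/2"
    by (auto simp: path_image_part_circlepath)
  show "norm w = R" using x assms by (simp add: norm_mult)
  have "cos x \<ge> 0" using x by (intro cos_ge_zero) auto
  thus "Re w \<ge> 0" using x assms by (simp add: Re_exp)
qed

lemma left_arc_image:
  assumes "R > 0" "w \<in> path_image (left_arc R)"
  shows "norm w = R" "Re w \<le> 0"
proof -
  from assms obtain x where x: "w = of_real R * exp (\<i> * of_real x)" "pi/2 \<le> x" "x \<le> 3*pi/2"
    by (auto simp: path_image_part_circlepath)
  show "norm w = R" using x assms by (simp add: norm_mult)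
  have "cos (x - pi) \<ge> 0" using x by (intro cos_ge_zero) auto
  thus "Re w \<le> 0" using x assms by (simp add: Re_exp mult_le_0_iff)
qed

lemma arc_integral_inverse:
  assumes "R > 0"
  shows "((\<lambda>w. 1 / w) has_contour_integral \<i> * pi) (right_arc R)"
    and "((\<lambda>w. 1 / w) has_contour_integral \<i> * pi) (left_arc R)"
proof -
  have *: "1 / (0 + complex_of_real R * cis t) * complex_of_real R * \<i> * cis t = \<i>" for t
    using assms by simp
  have "((\<lambda>t. 1 / (0 + complex_of_real R * cis t) * complex_of_real R * \<i> * cis t)
          has_integral \<i> * pi) {a..b}" if "b - a = pi" for a b
    unfolding * using has_integral_const_real[of \<i> a b] that pi_gt_zero
    by (simp add: scaleR_conv_of_real mult.commute content_real)
  from this[of "pi/2" "-(pi/2)"] this[of "3*pi/2" "pi/2"]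
  show "((\<lambda>w. 1 / w) has_contour_integral \<i> * pi) (right_arc R)"
    and "((\<lambda>w. 1 / w) has_contour_integral \<i> * pi) (left_arc R)"
    by (simp_all add: has_contour_integral_part_circlepath_iff)
qed

text \<open>Removing \<open>g 0 / w\<close> leaves a removable singularity, so the closed loop
  contributes nothing, and each half circle contributes \<open>\<i> * pi * g 0\<close>. Computing
  the two halves explicitly takes the place of a winding number.\<close>

lemma arcs_Cauchy_formula:
  assumes g: "g holomorphic_on UNIV" and R: "R > 0"
  shows "contour_integral (right_arc R) (\<lambda>w. g w / w) + contour_integral (left_arc R) (\<lambda>w. g w / w)
         = 2 * pi * \<i> * g 0"
proof -
  define h where "h = (\<lambda>z. if z = 0 then deriv g 0 else (g z - g 0) / (z - 0))"
  have hol: "h holomorphic_on UNIV"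
    unfolding h_def by (rule pole_lemma_open[OF g]) auto
  have val: "valid_path (right_arc R +++ left_arc R)"
    by (intro valid_path_join valid_path_part_circlepath)
       (simp_all add: exp_eq_polar)
  have loop: "pathfinish (right_arc R +++ left_arc R) = pathstart (right_arc R +++ left_arc R)"
    using cos_3over2_pi sin_3over2_pi
    by (simp add: exp_eq_polar complex_eq_iff mult.commute)
  have z: "contour_integral (right_arc R +++ left_arc R) h = 0"
    by (rule contour_integral_unique, rule Cauchy_theorem_convex_simple[OF hol])
       (use val loop in auto)
  have cont: "continuous_on A h" for A
    using hol holomorphic_on_imp_continuous_on continuous_on_subset by blast
  have intr: "h contour_integrable_on right_arc R" and intl: "h contour_integrable_on left_arc R"
    by (intro contour_integrable_continuous_part_circlepath cont)+
  have h0: "contour_integral (right_arc R) h + contour_integral (left_arc R) h = 0"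
    using z intr intl by (subst (asm) contour_integral_join) (auto intro: valid_path_part_circlepath)
  have eq: "g w / w = h w + g 0 * (1 / w)" if "w \<noteq> 0" for w
    using that by (simp add: h_def field_simps)
  have r: "((\<lambda>w. h w + g 0 * (1 / w)) has_contour_integral
            (contour_integral (right_arc R) h + g 0 * (\<i> * pi))) (right_arc R)"
    by (intro has_contour_integral_add has_contour_integral_lmul arc_integral_inverse
              has_contour_integral_integral intr R)
  have l: "((\<lambda>w. h w + g 0 * (1 / w)) has_contour_integral
            (contour_integral (left_arc R) h + g 0 * (\<i> * pi))) (left_arc R)"
    by (intro has_contour_integral_add has_contour_integral_lmul arc_integral_inverse
              has_contour_integral_integral intl R)
  have "contour_integral (right_arc R) (\<lambda>w. g w / w) = contour_integral (right_arc R) h + g 0 * (\<i> * pi)"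
    by (rule contour_integral_unique, rule has_contour_integral_eq[OF r])
       (use right_arc_image[OF R] R eq in force)
  moreover have "contour_integral (left_arc R) (\<lambda>w. g w / w) = contour_integral (left_arc R) h + g 0 * (\<i> * pi)"
    by (rule contour_integral_unique, rule has_contour_integral_eq[OF l])
       (use left_arc_image[OF R] R eq in force)
  ultimately show ?thesis using h0
    by (simp add: algebra_simps)
qed

text \<open>By Cauchy's theorem the arc may be replaced by the segment from \<open>-iR\<close> to \<open>iR\<close>, on which the
  exponential has modulus \<open>1\<close>, and integration by parts there gains the factor \<open>1 / a\<close>.\<close>
lemma arc_integral_exp_decay:
  assumes U: "open U" "{w. Re w \<ge> 0} \<subseteq> U" and H: "H holomorphic_on U" and R: "R > 0"
  obtains C where "C \<ge> 0"
    "\<And>a::real. a > 0 \<Longrightarrow> norm (contour_integral (right_arc R) (\<lambda>w. H w * exp (a * w))) \<le> C / a"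
proof -
  define l where "l = linepath (\<i> * of_real R) (-(\<i> * of_real R))"
  \<comment> \<open>The half disc is convex and contained in \<open>U\<close>, so Cauchy's theorem
    applies to the closed contour although \<open>U\<close> may be any open set around the
    half-plane.\<close>
  define K where "K = cball 0 R \<inter> {w. Re w \<ge> 0}"
  have cl: "closed_segment (\<i> * of_real R) (-(\<i> * of_real R)) \<subseteq> K"
    by (rule closed_segment_subset)
       (use R in \<open>auto simp: K_def norm_mult intro!: convex_Int convex_halfspace_Re_ge\<close>)
  have K: "convex K" "K \<subseteq> U"
    using U by (auto simp: K_def intro!: convex_Int convex_halfspace_Re_ge)
  have limg: "path_image l \<subseteq> K" using cl by (simp add: l_def)
  have rimg: "path_image (right_arc R) \<subseteq> K"
    using right_arc_image[OF R] by (auto simp: K_def)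
  have H': "deriv H holomorphic_on U"
    by (rule holomorphic_deriv[OF H U(1)])
  have cpt: "compact (path_image l)" by (simp add: l_def compact_segment)
  have "bounded (H ` path_image l)" "bounded (deriv H ` path_image l)"
    using cpt limg K H H'
    by (meson compact_continuous_image compact_imp_bounded continuous_on_subset
        holomorphic_on_imp_continuous_on subset_trans)+
  then obtain M1 M2 where M1: "\<And>w. w \<in> path_image l \<Longrightarrow> norm (H w) \<le> M1"
    and M2: "\<And>w. w \<in> path_image l \<Longrightarrow> norm (deriv H w) \<le> M2"
    unfolding bounded_iff by auto
  have ends: "\<i> * of_real R \<in> path_image l" "-(\<i> * of_real R) \<in> path_image l"
    by (simp_all add: l_def)
  have M1_nn: "M1 \<ge> 0" and M2_nn: "M2 \<ge> 0"
    using M1[OF ends(1)] M2[OF ends(1)] norm_ge_zero order_trans by blast+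
  have Re0: "Re w = 0" if "w \<in> path_image l" for w
    using that by (auto simp: l_def in_segment)
  show ?thesis
  \<comment> \<open>Each endpoint of the segment contributes \<open>M1\<close>, and its length
    \<open>2 * R\<close> is weighted with \<open>M2\<close>.\<close>
  proof (rule that[of "2 * M1 + M2 * (2 * R)"])
    show "0 \<le> 2 * M1 + M2 * (2 * R)" using M1_nn M2_nn R by simp
    fix a :: real assume a: "a > 0"
    define E :: "complex \<Rightarrow> complex" where "E = (\<lambda>w. exp (of_real a * w))"
    have holE: "E holomorphic_on A" for A unfolding E_def by (intro holomorphic_intros)
    have holHE: "(\<lambda>w. H w * E w) holomorphic_on U"
      by (intro holomorphic_intros H holE)
    have contHE: "continuous_on K (\<lambda>w. H w * E w)"
      using holHE K(2) continuous_on_subset holomorphic_on_imp_continuous_on by blast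
    have intr: "(\<lambda>w. H w * E w) contour_integrable_on right_arc R"
      by (intro contour_integrable_continuous_part_circlepath continuous_on_subset[OF contHE rimg])
    have intl: "(\<lambda>w. H w * E w) contour_integrable_on l"
      unfolding l_def
      by (intro contour_integrable_continuous_linepath continuous_on_subset[OF contHE cl])
    have "((\<lambda>w. H w * E w) has_contour_integral 0) (right_arc R +++ l)"
    proof (rule Cauchy_theorem_convex[OF contHE K(1) finite.emptyI])
      show "(\<lambda>w. H w * E w) field_differentiable at x" if "x \<in> interior K - {}" for x
        using that holHE K(2) U(1) interior_subset
        by (metis Diff_empty holomorphic_on_imp_differentiable_at subsetD)
      show "valid_path (right_arc R +++ l)"
        by (intro valid_path_join valid_path_part_circlepath) (simp_all add: l_def exp_eq_polar)
      show "path_image (right_arc R +++ l) \<subseteq> K"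
        using rimg limg by (intro subset_path_image_join)
      show "pathfinish (right_arc R +++ l) = pathstart (right_arc R +++ l)"
        by (simp add: l_def exp_eq_polar complex_eq_iff)
    qed
    hence sum0: "contour_integral (right_arc R) (\<lambda>w. H w * E w) + contour_integral l (\<lambda>w. H w * E w) = 0"
      using intr intl contour_integral_join contour_integral_unique
      by (metis l_def valid_path_linepath valid_path_part_circlepath)
    \<comment> \<open>\<open>D\<close> is the derivative of \<open>H w * E w / a\<close>. It differs
      from the integrand by \<open>deriv H w * E w / a\<close>, of size at most
      \<open>M2 / a\<close> because \<open>E\<close> has modulus 1 on the segment.\<close>
    define D where "D = (\<lambda>w. H w * E w + deriv H w * E w / a)"
    have prim: "(D has_contour_integral
        (H (pathfinish l) * E (pathfinish l) / a - H (pathstart l) * E (pathstart l) / a)) l"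
    proof (rule contour_integral_primitive[where S = U])
      fix x assume x: "x \<in> U"
      have dE: "(E has_field_derivative a * E x) (at x within U)"
        unfolding E_def by (auto intro!: derivative_eq_intros)
      show "((\<lambda>w. H w * E w / a) has_field_derivative D x) (at x within U)"
        using holomorphic_derivI[OF H U(1) x] a
        by (auto intro!: derivative_eq_intros dE simp: D_def field_simps)
    qed (use limg K in \<open>auto simp: l_def\<close>)
    define i1 where "i1 = contour_integral l (\<lambda>w. H w * E w)"
    have "((\<lambda>w. D w - H w * E w) has_contour_integral
        (H (pathfinish l) * E (pathfinish l) / a - H (pathstart l) * E (pathstart l) / a) - i1) l"
      unfolding i1_def by (intro has_contour_integral_diff prim has_contour_integral_integral intl)
    hence "norm ((H (pathfinish l) * E (pathfinish l) / a - H (pathstart l) * E (pathstart l) / a) - i1)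
            \<le> M2 / a * norm (-(\<i> * of_real R) - \<i> * of_real R)"
      unfolding l_def
    proof (rule has_contour_integral_bound_linepath)
      fix x assume "x \<in> closed_segment (\<i> * of_real R) (-(\<i> * of_real R))"
      hence x: "x \<in> path_image l" by (simp add: l_def)
      have "norm (D x - H x * E x) = norm (deriv H x) / a"
        using a Re0[OF x] by (simp add: D_def E_def norm_divide norm_mult)
      thus "norm (D x - H x * E x) \<le> M2 / a" using M2[OF x] a by (simp add: divide_right_mono)
    qed (use M2_nn a in simp)
    also have "norm (-(\<i> * of_real R) - \<i> * of_real R) = 2 * R"
      using R by (simp add: norm_mult flip: mult_2)
    finally have b1: "norm ((H (pathfinish l) * E (pathfinish l) / a - H (pathstart l) * E (pathstart l) / a) - i1)
            \<le> M2 / a * (2 * R)" .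
    have b2: "norm (H w * E w / a) \<le> M1 / a" if "w \<in> path_image l" for w
      using a Re0[OF that] M1[OF that] by (simp add: E_def norm_divide norm_mult divide_right_mono)
    have "norm i1 \<le> M2 / a * (2 * R) + M1 / a + M1 / a"
    proof -
      define u v where "u = H (pathfinish l) * E (pathfinish l) / a" 
        and "v = H (pathstart l) * E (pathstart l) / a"
      have "norm u \<le> M1 / a" "norm v \<le> M1 / a"
        unfolding u_def v_def using b2 ends by (simp_all add: l_def)
      moreover have "norm (u - v - i1) \<le> M2 / a * (2 * R)" using b1 unfolding u_def v_def .
      moreover have "norm i1 \<le> norm (u - v - i1) + norm u + norm v"
        by (smt (verit) norm_minus_commute norm_triangle_ineq4 norm_triangle_sub)
      ultimately show ?thesis by linarith
    qed
    also have "\<dots> = (2 * M1 + M2 * (2 * R)) / a" by (simp add: add_divide_distrib)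
    finally show "norm (contour_integral (right_arc R) (\<lambda>w. H w * exp (a * w))) \<le> (2 * M1 + M2 * (2 * R)) / a"
      using sum0 unfolding i1_def E_def by (metis add_eq_0_iff norm_minus_cancel)
  qed
qed

text \<open>The error splits into four arc integrals. Those of \<open>S n - F\<close> on the right
  and of \<open>S n\<close> on the left are at most \<open>2 * pi * B / R\<close> each: the kernel
  cancels \<open>1 / Re w\<close>, and the factor \<open>n^w\<close> cancels
  \<open>n powr (- Re w)\<close>. The other two, \<open>F 0\<close> on the left and the remainder of
  \<open>F\<close> on the right, are of order \<open>1 / ln n\<close>.\<close>

lemma newman_contour_bound:
  assumes U: "open U" "{w. Re w \<ge> 0} \<subseteq> U" and F: "F holomorphic_on U"
    and S: "\<And>n. S n holomorphic_on UNIV"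
    and B: "B > 0" and R: "R > 0"
    and right: "\<And>n w. n \<ge> 1 \<Longrightarrow> Re w > 0 \<Longrightarrow>
        norm (F w - S n w) \<le> B * real n powr (- Re w) / Re w"
    and left: "\<And>n w. n \<ge> 1 \<Longrightarrow> Re w < 0 \<Longrightarrow>
        norm (S n w) \<le> B * real n powr (- Re w) / (- Re w)"
  obtains C where "\<And>n. n \<ge> 2 \<Longrightarrow> 2 * pi * norm (S n 0 - F 0) \<le> 4 * pi * B / R + C / ln (real n)"
proof -
  \<comment> \<open>Since \<open>q 0 = 1\<close>, the kernel \<open>k w = q w / w\<close> has
    residue 1 at 0, and Cauchy's formula still returns the value at 0.\<close>
  define q where "q = (\<lambda>w. 1 + w ^ 2 / of_real R ^ 2 :: complex)"
  define k where "k = (\<lambda>w. 1 / w + w / of_real R ^ 2 :: complex)"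
  have qk: "q w / w = k w" if "w \<noteq> 0" for w
    using that by (simp add: q_def k_def field_simps power2_eq_square)
  have holq: "q holomorphic_on A" for A
    unfolding q_def using R by (intro holomorphic_intros) auto
  define H where "H = (\<lambda>w. (if w = 0 then deriv F 0 else (F w - F 0) / (w - 0)) * q w)"
  have holH: "H holomorphic_on U"
    unfolding H_def by (intro holomorphic_intros holq pole_lemma_open F U)
  obtain C where C: "C \<ge> 0" "\<And>a::real. a > 0 \<Longrightarrow>
      norm (contour_integral (right_arc R) (\<lambda>w. H w * exp (a * w))) \<le> C / a"
    using arc_integral_exp_decay[OF U holH R] by blast
  show ?thesis
  proof (rule that[of "C + norm (F 0) * (2 * pi / R)"])
    fix n :: nat assume n: "n \<ge> 2"
    define a where "a = ln (real n)"
    have a: "a > 0" using n by (simp add: a_def)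
    define E :: "complex \<Rightarrow> complex" where "E = (\<lambda>w. exp (of_real a * w))"
    have normE: "norm (E w) = real n powr Re w" for w
      using n by (simp add: E_def a_def powr_def mult.commute)
    have holE: "E holomorphic_on A" for A unfolding E_def by (intro holomorphic_intros)
    have r0: "w \<noteq> 0" if "w \<in> path_image (right_arc R)" for w
      using right_arc_image[OF R that] R by auto
    have l0: "w \<noteq> 0" if "w \<in> path_image (left_arc R)" for w
      using left_arc_image[OF R that] R by auto
    have rU: "path_image (right_arc R) \<subseteq> U"
      using right_arc_image[OF R] U by auto
    define P where "P = (\<lambda>w. S n w * k w * E w)"
    define Q where "Q = (\<lambda>w. F 0 * k w * E w)"
    have hk: "k holomorphic_on A" if "0 \<notin> A" for A
      unfolding k_def using R that by (intro holomorphic_intros) auto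
    have hP: "P holomorphic_on A" if "0 \<notin> A" for A
      unfolding P_def using S holE hk[OF that]
      by (intro holomorphic_intros) (auto intro: holomorphic_on_subset)
    have hQ: "Q holomorphic_on A" if "0 \<notin> A" for A
      unfolding Q_def using holE hk[OF that] by (intro holomorphic_intros)
    have ir: "f contour_integrable_on right_arc R"
      if "f holomorphic_on path_image (right_arc R)" for f
      using that by (intro contour_integrable_continuous_part_circlepath holomorphic_on_imp_continuous_on)
    have il: "f contour_integrable_on left_arc R"
      if "f holomorphic_on path_image (left_arc R)" for f
      using that by (intro contour_integrable_continuous_part_circlepath holomorphic_on_imp_continuous_on)
    have Pr: "P contour_integrable_on right_arc R" and Pl: "P contour_integrable_on left_arc R"
      and Qr: "Q contour_integrable_on right_arc R" and Ql: "Q contour_integrable_on left_arc R"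
      using r0 l0 by (auto intro!: ir il hP hQ)
    have HEr: "(\<lambda>w. H w * E w) contour_integrable_on right_arc R"
      using holH rU by (intro ir holomorphic_intros holE) (auto intro: holomorphic_on_subset)
    have cauchy: "contour_integral (right_arc R) (\<lambda>w. f w * k w * E w)
          + contour_integral (left_arc R) (\<lambda>w. f w * k w * E w) = 2 * pi * \<i> * f 0"
      if "f holomorphic_on UNIV" for f
    proof -
      define g where "g = (\<lambda>w. f w * q w * E w)"
      have "contour_integral (right_arc R) (\<lambda>w. g w / w) + contour_integral (left_arc R) (\<lambda>w. g w / w)
         = 2 * pi * \<i> * g 0"
        by (intro arcs_Cauchy_formula R) (auto simp: g_def intro!: holomorphic_intros that holq holE)
      moreover have "g 0 = f 0" by (simp add: g_def q_def E_def)
      moreover have "g w / w = f w * k w * E w" if "w \<noteq> 0" for w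
        using qk[OF that] by (simp add: g_def flip: qk[OF that])
      hence "contour_integral (right_arc R) (\<lambda>w. g w / w) = contour_integral (right_arc R) (\<lambda>w. f w * k w * E w)"
        "contour_integral (left_arc R) (\<lambda>w. g w / w) = contour_integral (left_arc R) (\<lambda>w. f w * k w * E w)"
        using r0 l0 by (auto intro!: contour_integral_cong)
      ultimately show ?thesis by simp
    qed
    have cP: "contour_integral (right_arc R) P + contour_integral (left_arc R) P = 2 * pi * \<i> * S n 0"
      unfolding P_def by (rule cauchy[OF S])
    have cQ: "contour_integral (right_arc R) Q + contour_integral (left_arc R) Q = 2 * pi * \<i> * F 0"
      unfolding Q_def by (rule cauchy) auto
    define I1 where "I1 = contour_integral (right_arc R) P
        - (contour_integral (right_arc R) Q + contour_integral (right_arc R) (\<lambda>w. H w * E w))"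
    have hI1: "((\<lambda>w. P w - (Q w + H w * E w)) has_contour_integral I1) (right_arc R)"
      unfolding I1_def by (intro has_contour_integral_diff has_contour_integral_add
          has_contour_integral_integral Pr Qr HEr)
    have "norm I1 \<le> 2 * B / R\<^sup>2 * R * (pi / 2 - -(pi / 2))"
    \<comment> \<open>At the endpoints of the arc the real part is 0 and \<open>right\<close> gives
      no bound; a finite set may be left out of the estimate.\<close>
    proof (rule has_contour_integral_bound_part_circlepath_strong[OF hI1, where k = "{\<i> * of_real R, -(\<i> * of_real R)}"])
      fix w assume w: "w \<in> path_image (right_arc R) - {\<i> * of_real R, -(\<i> * of_real R)}"
      hence nw: "norm w = R" "Re w \<ge> 0" "w \<noteq> 0"
        using right_arc_image[OF R] r0 by auto
      have "Re w \<noteq> 0"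
      proof
        assume "Re w = 0"
        hence "Im w = R \<or> Im w = -R" using nw(1) by (auto simp: cmod_def)
        with \<open>Re w = 0\<close> w show False by (auto simp: complex_eq_iff)
      qed
      with nw have x: "Re w > 0" by simp
      have "P w - (Q w + H w * E w) = (S n w - F w) * k w * E w"
        using nw(3) by (simp add: P_def Q_def H_def field_simps flip: qk[OF nw(3)])
      hence "norm (P w - (Q w + H w * E w)) = norm (F w - S n w) * norm (k w) * norm (E w)"
        by (simp add: norm_mult norm_minus_commute)
      also have "\<dots> \<le> (B * real n powr (- Re w) / Re w) * (2 * \<bar>Re w\<bar> / R\<^sup>2) * real n powr Re w"
        using right[of n w] n x newman_kernel_norm[OF nw(1) R] B unfolding normE k_def
        by (intro mult_mono) auto
      also have "\<dots> = 2 * B / R\<^sup>2 * (real n powr (- Re w) * real n powr Re w)"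
        using x by (simp add: field_simps)
      also have "real n powr (- Re w) * real n powr Re w = 1"
        using n by (simp flip: powr_add)
      finally show "norm (P w - (Q w + H w * E w)) \<le> 2 * B / R\<^sup>2" by simp
    qed (use B R in auto)
    hence b1: "norm I1 \<le> 2 * pi * B / R" using R by (simp add: power2_eq_square field_simps)
    have "norm (contour_integral (left_arc R) P) \<le> 2 * B / R\<^sup>2 * R * (3 * pi / 2 - pi / 2)"
    proof (rule has_contour_integral_bound_part_circlepath_strong
            [OF has_contour_integral_integral[OF Pl], where k = "{\<i> * of_real R, -(\<i> * of_real R)}"])
      fix w assume w: "w \<in> path_image (left_arc R) - {\<i> * of_real R, -(\<i> * of_real R)}"
      hence nw: "norm w = R" "Re w \<le> 0" "w \<noteq> 0"
        using left_arc_image[OF R] l0 by auto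
      have "Re w \<noteq> 0"
      proof
        assume "Re w = 0"
        hence "Im w = R \<or> Im w = -R" using nw(1) by (auto simp: cmod_def)
        with \<open>Re w = 0\<close> w show False by (auto simp: complex_eq_iff)
      qed
      with nw have x: "Re w < 0" by simp
      have "norm (P w) = norm (S n w) * norm (k w) * norm (E w)"
        by (simp add: P_def norm_mult)
      also have "\<dots> \<le> (B * real n powr (- Re w) / (- Re w)) * (2 * \<bar>Re w\<bar> / R\<^sup>2) * real n powr Re w"
        using left[of n w] n x newman_kernel_norm[OF nw(1) R] B unfolding normE k_def
        by (intro mult_mono) (auto simp: divide_nonneg_neg divide_le_0_iff)
      also have "\<dots> = 2 * B / R\<^sup>2 * (real n powr (- Re w) * real n powr Re w)"
        using x by (simp add: field_simps)
      also have "real n powr (- Re w) * real n powr Re w = 1"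
        using n by (simp flip: powr_add)
      finally show "norm (P w) \<le> 2 * B / R\<^sup>2" by simp
    qed (use B R in auto)
    hence b2: "norm (contour_integral (left_arc R) P) \<le> 2 * pi * B / R"
      using R by (simp add: power2_eq_square field_simps)
    have "norm (contour_integral (left_arc R) Q) \<le> norm (F 0) * 2 / (R\<^sup>2 * a) * R * (3 * pi / 2 - pi / 2)"
    proof (rule has_contour_integral_bound_part_circlepath[OF has_contour_integral_integral[OF Ql]])
      fix w assume w: "w \<in> path_image (left_arc R)"
      hence nw: "norm w = R" "Re w \<le> 0" using left_arc_image[OF R] by auto
      \<comment> \<open>No \<open>1 / Re w\<close> has to be cancelled for \<open>Q\<close>, so the
        factor \<open>\<bar>Re w\<bar>\<close> of the kernel is free to produce decay through
        \<open>t * exp (-t) \<le> 1\<close>.\<close>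
      have "a * \<bar>Re w\<bar> \<le> exp (a * \<bar>Re w\<bar>)"
        using exp_ge_add_one_self[of "a * \<bar>Re w\<bar>"] by linarith
      hence "a * \<bar>Re w\<bar> * exp (-(a * \<bar>Re w\<bar>)) \<le> 1"
        by (simp add: exp_minus field_simps)
      moreover have "norm (E w) = exp (-(a * \<bar>Re w\<bar>))"
        using nw by (simp add: E_def)
      ultimately have *: "\<bar>Re w\<bar> * norm (E w) \<le> 1 / a" using a by (simp add: field_simps)
      have "norm (Q w) = norm (F 0) * (2 / R\<^sup>2) * (\<bar>Re w\<bar> * norm (E w))"
        using newman_kernel_norm[OF nw(1) R] by (simp add: Q_def k_def norm_mult)
      also have "\<dots> \<le> norm (F 0) * (2 / R\<^sup>2) * (1 / a)"
        by (intro mult_left_mono *) auto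
      finally show "norm (Q w) \<le> norm (F 0) * 2 / (R\<^sup>2 * a)" by simp
    qed (use a R in auto)
    hence b3: "norm (contour_integral (left_arc R) Q) \<le> norm (F 0) * (2 * pi / R) / a"
      using R by (simp add: power2_eq_square field_simps)
    have b4: "norm (contour_integral (right_arc R) (\<lambda>w. H w * E w)) \<le> C / a"
      using C(2)[OF a] by (simp add: E_def)
    have "2 * pi * \<i> * (S n 0 - F 0)
       = I1 + contour_integral (right_arc R) (\<lambda>w. H w * E w) - contour_integral (left_arc R) Q
         + contour_integral (left_arc R) P"
      unfolding right_diff_distrib cP[symmetric] cQ[symmetric] I1_def by simp
    hence "norm (2 * pi * \<i> * (S n 0 - F 0)) \<le> norm I1 + norm (contour_integral (right_arc R) (\<lambda>w. H w * E w))
        + norm (contour_integral (left_arc R) Q) + norm (contour_integral (left_arc R) P)"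
      by (smt (verit) norm_triangle_ineq norm_triangle_ineq4)
    also have "norm (2 * pi * \<i> * (S n 0 - F 0)) = 2 * pi * norm (S n 0 - F 0)"
      by (simp add: norm_mult)
    finally have "2 * pi * norm (S n 0 - F 0) \<le> 2 * pi * B / R + C / a + norm (F 0) * (2 * pi / R) / a + 2 * pi * B / R"
      using b1 b2 b3 b4 by linarith
    thus "2 * pi * norm (S n 0 - F 0) \<le> 4 * pi * B / R + (C + norm (F 0) * (2 * pi / R)) / ln (real n)"
      unfolding a_def[symmetric] by (simp add: add_divide_distrib algebra_simps)
  qed
qed

text \<open>The part \<open>4 * pi * B / R\<close> of the contour bound does not depend on
  \<open>n\<close>. It is made small by the choice of \<open>R\<close>; the constant
  \<open>C\<close> may depend on \<open>R\<close>, because it is divided by \<open>ln n\<close>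
  afterwards.\<close>

theorem newman_tauberian:
  assumes "open U" "{w. Re w \<ge> 0} \<subseteq> U" and "F holomorphic_on U"
    and "\<And>n. S n holomorphic_on UNIV"
    and B: "B > 0"
    and "\<And>n w. n \<ge> 1 \<Longrightarrow> Re w > 0 \<Longrightarrow>
        norm (F w - S n w) \<le> B * real n powr (- Re w) / Re w"
    and "\<And>n w. n \<ge> 1 \<Longrightarrow> Re w < 0 \<Longrightarrow>
        norm (S n w) \<le> B * real n powr (- Re w) / (- Re w)"
  shows "(\<lambda>n. S n 0) \<longlonglongrightarrow> F 0"
proof (rule LIMSEQ_I)
  fix e :: real assume e: "e > 0"
  \<comment> \<open>Makes \<open>4 * pi * B / R\<close> half of the permitted
    \<open>2 * pi * e\<close>.\<close>
  define R where "R = 4 * B / e"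
  have R: "R > 0" using e B by (simp add: R_def)
  obtain C where C: "\<And>n. n \<ge> 2 \<Longrightarrow> 2 * pi * norm (S n 0 - F 0) \<le> 4 * pi * B / R + C / ln (real n)"
    using newman_contour_bound[OF assms(1-5) R assms(6,7)] by blast
  have "(\<lambda>n::nat. C / ln (real n)) \<longlonglongrightarrow> 0" by real_asymp
  moreover have "pi * e > 0" using e by simp
  ultimately have "eventually (\<lambda>n. C / ln (real n) < pi * e) sequentially"
    by (rule order_tendstoD)
  hence "eventually (\<lambda>n. norm (S n 0 - F 0) < e) sequentially"
    using eventually_ge_at_top[of 2]
  proof eventually_elim
    case (elim n)
    have *: "4 * pi * B / R = pi * e" using B e by (simp add: R_def)
    have "(2 * pi) * norm (S n 0 - F 0) \<le> pi * e + C / ln (real n)"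
      using C[OF elim(2)] unfolding * .
    also have "\<dots> < pi * e + pi * e" using elim(1) by simp
    also have "\<dots> = (2 * pi) * e" by simp
    finally have "(2 * pi) * norm (S n 0 - F 0) < (2 * pi) * e" .
    thus ?case by (rule mult_left_less_imp_less) simp
  qed
  thus "\<exists>no. \<forall>n\<ge>no. norm (S n 0 - F 0) < e"
    by (simp add: eventually_sequentially)
qed

section \<open>The zeta function\<close>

lemma suminf_holomorphic:
  fixes f :: "nat \<Rightarrow> complex \<Rightarrow> complex"
  assumes S: "open S" and f: "\<And>n. f n holomorphic_on S"
    and bound: "\<And>z. z \<in> S \<Longrightarrow> \<exists>d h. 0 < d \<and> summable h \<and>
        (\<forall>\<^sub>F n in sequentially. \<forall>y\<in>ball z d \<inter> S. norm (f n y) \<le> h n)"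
  shows "(\<lambda>z. \<Sum>n. f n z) holomorphic_on S"
    and "z \<in> S \<Longrightarrow> (\<lambda>n. deriv (f n) z) sums deriv (\<lambda>z. \<Sum>n. f n z) z"
proof -
  obtain g g' where g: "\<forall>x \<in> S. ((\<lambda>n. f n x) sums g x) \<and> ((\<lambda>n. deriv (f n) x) sums g' x) \<and> (g has_field_derivative g' x) (at x)"
    using series_and_derivative_comparison_local[where f = f and f' = "\<lambda>n. deriv (f n)", OF S holomorphic_derivI[OF f S] bound]
    by blast
  have eq: "(\<Sum>n. f n x) = g x" if "x \<in> S" for x
    using g that by (simp add: sums_unique[symmetric])
  have der: "((\<lambda>z. \<Sum>n. f n z) has_field_derivative g' x) (at x)" if "x \<in> S" for x
    by (rule has_field_derivative_transform_within_open[where f = g and S = S]) (use g that eq S in auto)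
  show "(\<lambda>z. \<Sum>n. f n z) holomorphic_on S"
    using der S holomorphic_on_open by blast
  show "z \<in> S \<Longrightarrow> (\<lambda>n. deriv (f n) z) sums deriv (\<lambda>z. \<Sum>n. f n z) z"
    using der g DERIV_imp_deriv by metis
qed

lemma has_field_derivative_powr_of_real:
  assumes "z \<in> closed_segment (of_nat n) (of_nat (Suc n))" "n > 0"
  shows "((\<lambda>z. z powr c) has_field_derivative c * z powr (c - 1)) (at z within S)"
    and "norm (z powr c) = Re z powr Re c" "real n \<le> Re z"
proof -
  obtain u where u: "z = (1 - u) *\<^sub>R of_nat n + u *\<^sub>R of_nat (Suc n)" "0 \<le> u" "u \<le> 1"
    using assms(1) by (auto simp: closed_segment_def)
  hence z: "z = of_real (real n + u)"
    by (simp add: scaleR_conv_of_real algebra_simps)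
  hence "z \<notin> \<real>\<^sub>\<le>\<^sub>0" using u(2) assms(2) by (simp only: complex_nonpos_Reals_iff) simp
  thus "((\<lambda>z. z powr c) has_field_derivative c * z powr (c - 1)) (at z within S)"
    by (intro DERIV_subset[OF has_field_derivative_powr]) auto
  show "norm (z powr c) = Re z powr Re c"
    using z u(2) by (intro norm_powr_real_powr) auto
  show "real n \<le> Re z" using z u by simp
qed

text \<open>For \<open>n > 0\<close> this is \<open>s - 1\<close> times the difference of
  \<open>n powr (-s)\<close> and the integral of \<open>x powr (-s)\<close> over
  \<open>[n, n + 1]\<close>. The difference is one order smaller than either part, which moves the
  region of convergence from \<open>Re s > 1\<close> to \<open>Re s > 0\<close>.\<close>

definition zeta_term :: "nat \<Rightarrow> complex \<Rightarrow> complex" where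
  "zeta_term n s = (s - 1) * of_nat n powr (-s) - of_nat n powr (1 - s) + of_nat (Suc n) powr (1 - s)"

text \<open>The regularised zeta function \<open>(s - 1) \<zeta>(s)\<close>; the term \<open>n = 0\<close> contributes \<open>1\<close>
  because \<open>0 powr s = 0\<close>.\<close>
definition zeta_reg :: "complex \<Rightarrow> complex" where
  "zeta_reg s = (\<Sum>n. zeta_term n s)"

text \<open>The term is the increment over \<open>[n, n + 1]\<close> of the function
  \<open>f\<close> in the proof, whose derivative is \<open>s - 1\<close> times a difference of two
  values of \<open>z powr (-s)\<close>. A second mean value estimate of that difference gains the
  factor \<open>1 / n\<close>.\<close>

lemma zeta_term_bound:
  assumes n: "n > 0" and s: "Re s > 0"
  shows "norm (zeta_term n s) \<le> norm (s - 1) * norm s * real n powr (- Re s - 1)"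
proof -
  define A where "A = closed_segment (of_nat n :: complex) (of_nat (Suc n))"
  have A: "of_nat n \<in> A" "of_nat (Suc n) \<in> A" "convex A" by (auto simp: A_def)
  have diff1: "norm (z - of_nat n) \<le> 1" if "z \<in> A" for z
    using segment_bound1[of z "of_nat n" "of_nat (Suc n)"] that by (simp add: A_def)
  have 1: "norm (z powr (-s) - of_nat n powr (-s)) \<le> norm s * real n powr (- Re s - 1)" if z: "z \<in> A" for z
  proof -
    have "norm (z powr (-s) - of_nat n powr (-s)) \<le> norm s * real n powr (- Re s - 1) * norm (z - of_nat n)"
    proof (rule field_differentiable_bound[OF A(3) _ _ z A(1)])
      fix w assume w: "w \<in> A"
      show "((\<lambda>z. z powr (-s)) has_field_derivative (-s) * w powr (-s - 1)) (at w within A)"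
        using w n unfolding A_def by (intro has_field_derivative_powr_of_real)
      show "norm ((-s) * w powr (-s - 1)) \<le> norm s * real n powr (- Re s - 1)"
        using has_field_derivative_powr_of_real(2,3)[of w n] w n s
        by (auto simp: A_def norm_mult intro!: mult_left_mono powr_mono2')
    qed
    also have "\<dots> \<le> norm s * real n powr (- Re s - 1) * 1"
      by (intro mult_left_mono diff1 z) auto
    finally show ?thesis by simp
  qed
  define f where "f = (\<lambda>z. (s - 1) * of_nat n powr (-s) * z + z powr (1 - s))"
  have "norm (f (of_nat (Suc n)) - f (of_nat n))
     \<le> norm (s - 1) * (norm s * real n powr (- Re s - 1)) * norm (of_nat (Suc n) - of_nat n :: complex)"
  proof (rule field_differentiable_bound[OF A(3) _ _ A(2,1)])
    fix z assume z: "z \<in> A"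
    show "(f has_field_derivative (s - 1) * (of_nat n powr (-s) - z powr (-s))) (at z within A)"
      unfolding f_def
      by (rule derivative_eq_intros has_field_derivative_powr_of_real(1)[of _ n] z[unfolded A_def] n refl)+
         (simp add: algebra_simps)
    show "norm ((s - 1) * (of_nat n powr (-s) - z powr (-s))) \<le> norm (s - 1) * (norm s * real n powr (- Re s - 1))"
      using 1[OF z] by (simp add: norm_mult norm_minus_commute mult_left_mono)
  qed
  also have "f (of_nat (Suc n)) - f (of_nat n) = zeta_term n s"
    by (simp add: f_def zeta_term_def algebra_simps)
  finally show ?thesis by (simp add: mult.assoc)
qed

lemma zeta_reg_holomorphic: "zeta_reg holomorphic_on {s. Re s > 0}"
proof -
  have op: "open {s. Re s > 0}" by (rule open_halfspace_Re_gt)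
  have hol: "zeta_term n holomorphic_on A" for n A
    unfolding zeta_term_def by (intro holomorphic_intros)
  have bd: "\<exists>d h. 0 < d \<and> summable h \<and>
        (\<forall>\<^sub>F n in sequentially. \<forall>y\<in>ball z d \<inter> {s. Re s > 0}. norm (zeta_term n y) \<le> h n)"
    if "z \<in> {s. Re s > 0}" for z
  proof -
    define d where "d = Re z / 2"
    define h where "h = (\<lambda>n::nat. (norm z + d + 1) * (norm z + d) * real n powr (- d - 1))"
    have d: "d > 0" using that by (simp add: d_def)
    have sum: "summable h" unfolding h_def using d by (intro summable_mult) (simp add: summable_real_powr_iff)
    have "norm (zeta_term n y) \<le> h n" if n: "n > 0" and y: "y \<in> ball z d \<inter> {s. Re s > 0}" for n y
    proof -
      have "norm (z - y) < d" using y by (simp add: dist_norm)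
      hence ny: "norm y \<le> norm z + d" and ry: "Re y \<ge> d"
        using norm_triangle_ineq2[of y z] abs_Re_le_cmod[of "z - y"]
        by (auto simp: norm_minus_commute d_def)
      have "norm (y - 1) \<le> norm z + d + 1"
        using norm_triangle_ineq4[of y 1] ny by simp
      hence "norm (y - 1) * norm y * real n powr (- Re y - 1) \<le> h n"
        unfolding h_def using ny ry n d by (intro mult_mono powr_mono) auto
      with zeta_term_bound[OF n, of y] y show ?thesis by auto
    qed
    hence "\<forall>\<^sub>F n in sequentially. \<forall>y\<in>ball z d \<inter> {s. Re s > 0}. norm (zeta_term n y) \<le> h n"
      by (intro eventually_mono[OF eventually_gt_at_top[of 0]]) auto
    with d sum show ?thesis by blast
  qed
  show "zeta_reg holomorphic_on {s. Re s > 0}"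
    unfolding zeta_reg_def by (rule suminf_holomorphic(1)[OF op hol bd])
qed

lemma zeta_reg_1 [simp]: "zeta_reg 1 = 1"
proof -
  have "zeta_term n 1 = (if n = 0 then 1 else 0)" for n
    by (simp add: zeta_term_def del: of_nat_Suc)
  thus ?thesis using suminf_finite[of "{0}" "\<lambda>n. zeta_term n 1"] by (simp add: zeta_reg_def)
qed

lemma summable_zeta:
  assumes "Re s > 1"
  shows "summable (\<lambda>n. of_nat n powr (-s) :: complex)"
  by (rule summable_norm_cancel) (use assms in \<open>simp add: norm_powr_real_powr summable_real_powr_iff\<close>)

lemma zeta_reg_eq:
  assumes "Re s > 1"
  shows "zeta_reg s = (s - 1) * (\<Sum>n. of_nat n powr (-s))"
proof -
  have "(\<lambda>n. of_nat n powr (1 - s) :: complex) \<longlonglongrightarrow> 0"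
    by (rule tendsto_neg_powr_complex_of_nat) (use assms in \<open>auto simp: filterlim_ident\<close>)
  \<comment> \<open>The telescoping sum is 0 because it starts at
    \<open>0 powr (1 - s) = 0\<close>.\<close>
  from telescope_sums[OF this] 
  have "(\<lambda>n. of_nat (Suc n) powr (1 - s) - of_nat n powr (1 - s) :: complex) sums 0" by simp
  from sums_add[OF sums_mult[OF summable_sums[OF summable_zeta[OF assms]], of "s - 1"] this]
  have "(\<lambda>n. zeta_term n s) sums ((s - 1) * (\<Sum>n. of_nat n powr (-s)))"
    by (simp add: zeta_term_def algebra_simps)
  thus ?thesis unfolding zeta_reg_def by (rule sums_unique[symmetric])
qed

section \<open>The Dirichlet series of the von Mangoldt function\<close>

text \<open>The absolutely convergent double series is regrouped along
  \<open>(x, y) \<mapsto> (x * y, x)\<close>. Index 0 has to be excluded beforehand: every number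
  divides 0, so its fibre would be infinite.\<close>

lemma dirichlet_product_sums:
  fixes f g :: "nat \<Rightarrow> complex"
  assumes f: "summable (\<lambda>n. norm (f n))" "f sums a" and g: "summable (\<lambda>n. norm (g n))" "g sums b"
    and z: "f 0 = 0" "g 0 = 0"
  shows "(\<lambda>n. if n = 0 then 0 else \<Sum>d | d dvd n. f d * g (n div d)) sums (a * b)"
proof -
  have neutral: "(h has_sum c) {0<..}" if "(h has_sum c) UNIV" "h 0 = 0" for h :: "nat \<Rightarrow> complex" and c
    using that has_sum_cong_neutral[of "{0<..}" UNIV h h c] by auto
  have f': "(f has_sum a) {0<..}" and g': "(g has_sum b) {0<..}"
    using norm_summable_imp_has_sum[OF f] norm_summable_imp_has_sum[OF g] z neutral by auto
  have fa: "(\<lambda>x. norm (f x)) summable_on {0<..}" and ga: "(\<lambda>x. norm (g x)) summable_on {0<..}"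
    using f(1) g(1) by (auto intro!: summable_on_subset_banach[OF norm_summable_imp_summable_on, of _ "{0<..}"])
  have abs: "(\<lambda>z. norm ((\<lambda>(x, y). f x * g y) z)) summable_on ({0<..} \<times> {0<..})"
    unfolding Infinite_Sum.abs_summable_on_Sigma_iff
    by (auto simp: norm_mult infsum_cmult_right' abs_mult intro!: summable_on_cmult_right ga fa summable_on_cmult_left)
  have "((\<lambda>(x, y). f x * g y) has_sum a * b) ({0<..} \<times> {0<..})"
  proof (rule has_sum_SigmaI)
    show "((\<lambda>y. case (x, y) of (x, y) \<Rightarrow> f x * g y) has_sum f x * b) {0<..}" for x
      by (simp add: has_sum_cmult_right g')
    show "((\<lambda>x. f x * b) has_sum a * b) {0<..}"
      by (rule has_sum_cmult_left[OF f'])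
  qed (rule abs_summable_summable[OF abs])
  hence "((\<lambda>(n, d). f d * g (n div d)) has_sum a * b) (Sigma {0<..} (\<lambda>n. {d. d dvd n}))"
    by (rule has_sum_reindex_bij_witness[where i = "\<lambda>(n, d). (d, n div d)" and j = "\<lambda>(x, y). (x * y, x)", THEN iffD1, rotated -1])
       (auto elim!: dvdE)
  hence "((\<lambda>n. \<Sum>d | d dvd n. f d * g (n div d)) has_sum a * b) {0<..}"
    by (rule has_sum_SigmaD) (auto intro!: has_sum_finite)
  hence "((\<lambda>n. if n = 0 then 0 else \<Sum>d | d dvd n. f d * g (n div d)) has_sum a * b) UNIV"
    by (subst has_sum_cong_neutral[where T = "{0<..}"]) auto
  thus ?thesis by (rule has_sum_imp_sums)
qed

lemma mangoldt_le_ln: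
  assumes "n > 0"
  shows "mangoldt n \<le> ln (real n)"
proof -
  have "mangoldt n \<le> (\<Sum>d | d dvd n. mangoldt d :: real)"
    using assms by (intro member_le_sum) (auto simp: mangoldt_nonneg)
  also have "\<dots> = ln (real n)" using mangoldt_sum[of n, where ?'a = real] assms by simp
  finally show ?thesis .
qed

lemma summable_ln_powr:
  assumes "x > 1"
  shows "summable (\<lambda>n. ln (real n) * real n powr (-x))"
proof (rule summable_comparison_test_bigo)
  show "summable (\<lambda>n. norm (real n powr (-(x + 1) / 2)))"
    using assms by (simp add: summable_real_powr_iff)
  \<comment> \<open>The exponent \<open>(x + 1) / 2\<close> lies strictly between 1 and
    \<open>x\<close>: the gap to \<open>x\<close> absorbs the logarithm, the gap to 1 gives
    convergence.\<close>
  show "(\<lambda>n. ln (real n) * real n powr (-x)) \<in> O(\<lambda>n. real n powr (-(x + 1) / 2))"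
    using assms by real_asymp
qed

definition mangoldt_series :: "complex \<Rightarrow> complex" where
  "mangoldt_series s = (\<Sum>n. mangoldt n * of_nat n powr (-s))"

lemma summable_norm_mangoldt_series:
  assumes "Re s > 1"
  shows "summable (\<lambda>n. norm (mangoldt n * of_nat n powr (-s) :: complex))"
proof (rule summable_comparison_test'[OF summable_ln_powr[OF assms], of 1])
  fix n :: nat assume "n \<ge> 1"
  thus "norm (norm (mangoldt n * of_nat n powr (-s) :: complex)) \<le> ln (real n) * real n powr (- Re s)"
    using mangoldt_le_ln[of n] by (auto simp: norm_mult norm_powr_real_powr abs_mult intro!: mult_right_mono)
qed

lemma deriv_zeta:
  assumes "Re s > 1"
  shows "((\<lambda>s. \<Sum>n. of_nat n powr (-s)) has_field_derivative
           (\<Sum>n. - of_real (ln (real n)) * of_nat n powr (-s))) (at s)"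
proof -
  have op: "open {s. Re s > 1}" by (rule open_halfspace_Re_gt)
  have hol: "(\<lambda>s. of_nat n powr (-s) :: complex) holomorphic_on A" for n A
    by (intro holomorphic_intros)
  have bd: "\<exists>d h. 0 < d \<and> summable h \<and>
        (\<forall>\<^sub>F n in sequentially. \<forall>y\<in>ball z d \<inter> {s. Re s > 1}. norm (of_nat n powr (-y) :: complex) \<le> h n)"
    if "z \<in> {s. Re s > 1}" for z
  proof -
    define d where "d = (Re z - 1) / 2"
    have d: "d > 0" using that by (simp add: d_def)
    have "norm (of_nat n powr (-y) :: complex) \<le> real n powr (-1 - d)"
      if n: "n > 0" and y: "y \<in> ball z d" for n y
    proof -
      have "\<bar>Re (z - y)\<bar> < d"
        using y abs_Re_le_cmod[of "z - y"] by (simp add: dist_norm)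
      moreover have "2 * d = Re z - 1" by (simp add: d_def)
      ultimately have "Re y \<ge> 1 + d" unfolding minus_complex.sel by linarith
      thus ?thesis using n by (simp add: norm_powr_real_powr powr_mono)
    qed
    hence "\<forall>\<^sub>F n in sequentially. \<forall>y\<in>ball z d \<inter> {s. Re s > 1}. norm (of_nat n powr (-y) :: complex) \<le> real n powr (-1 - d)"
      by (intro eventually_mono[OF eventually_gt_at_top[of 0]]) auto
    moreover have "summable (\<lambda>n. real n powr (-1 - d))" using d by (simp add: summable_real_powr_iff)
    ultimately show ?thesis using d by blast
  qed
  have dn: "deriv (\<lambda>s. of_nat n powr (-s) :: complex) s = - of_real (ln (real n)) * of_nat n powr (-s)" for n
  proof (cases "n = 0")
    case False
    have "((\<lambda>s. of_nat n powr (-s) :: complex) has_field_derivative - of_real (ln (real n)) * of_nat n powr (-s)) (at s)"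
      using DERIV_chain2[OF has_field_derivative_powr_right[of "of_nat n" "-s"] DERIV_minus[OF DERIV_ident]] False
      by simp
    thus ?thesis by (rule DERIV_imp_deriv)
  qed auto
  have "(\<lambda>s. \<Sum>n. of_nat n powr (-s) :: complex) holomorphic_on {s. Re s > 1}"
    by (rule suminf_holomorphic(1)[OF op hol bd])
  hence "((\<lambda>s. \<Sum>n. of_nat n powr (-s) :: complex) has_field_derivative deriv (\<lambda>s. \<Sum>n. of_nat n powr (-s)) s) (at s)"
    using op assms by (intro holomorphic_derivI) auto
  moreover have "(\<lambda>n. - of_real (ln (real n)) * of_nat n powr (-s)) sums deriv (\<lambda>s. \<Sum>n. of_nat n powr (-s) :: complex) s"
    using suminf_holomorphic(2)[OF op hol bd, of s] assms unfolding dn by simp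
  ultimately show ?thesis by (simp only: sums_unique[symmetric])
qed

text \<open>The convolution identity that the von Mangoldt function sums to \<open>ln n\<close> over
  the divisors of \<open>n\<close>, read through the Dirichlet product with the constant function
  1.\<close>

lemma mangoldt_series_times_zeta:
  assumes s: "Re s > 1"
  shows "mangoldt_series s * (\<Sum>n. of_nat n powr (-s)) = (\<Sum>n. of_real (ln (real n)) * of_nat n powr (-s))"
proof -
  have nz: "summable (\<lambda>n. norm (of_nat n powr (-s) :: complex))"
    using s by (simp add: norm_powr_real_powr summable_real_powr_iff)
  have nm: "summable (\<lambda>n. norm (mangoldt n * of_nat n powr (-s) :: complex))"
    by (rule summable_norm_mangoldt_series[OF s])
  have "(\<lambda>n. if n = 0 then 0 else \<Sum>d | d dvd n. mangoldt d * of_nat d powr (-s) * of_nat (n div d) powr (-s))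
          sums (mangoldt_series s * (\<Sum>n. of_nat n powr (-s)))"
    unfolding mangoldt_series_def
    by (intro dirichlet_product_sums nz nm summable_sums summable_norm_cancel[OF nz]
        summable_norm_cancel[OF nm]) auto
  moreover have "(if n = 0 then 0 else \<Sum>d | d dvd n. mangoldt d * of_nat d powr (-s) * of_nat (n div d) powr (-s))
       = of_real (ln (real n)) * of_nat n powr (-s)" for n
  proof (cases "n = 0")
    case False
    have "(\<Sum>d | d dvd n. mangoldt d * of_nat d powr (-s) * of_nat (n div d) powr (-s))
        = (\<Sum>d | d dvd n. mangoldt d * of_nat n powr (-s))"
    proof (rule sum.cong)
      fix d assume "d \<in> {d. d dvd n}"
      then obtain k where k: "n = d * k" by auto
      with False have "d \<noteq> 0" by auto
      hence "of_nat n powr (-s) = (of_nat d powr (-s) * of_nat (n div d) powr (-s) :: complex)"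
        using k by (simp add: powr_times_real)
      thus "mangoldt d * of_nat d powr (-s) * of_nat (n div d) powr (-s) = mangoldt d * of_nat n powr (-s)"
        by simp
    qed auto
    also have "\<dots> = of_real (ln (real n)) * of_nat n powr (-s)"
      using False by (simp add: mangoldt_sum flip: sum_distrib_right)
    finally show ?thesis using False by simp
  qed auto
  ultimately show ?thesis by (simp add: sums_unique)
qed

text \<open>This is \<open>- \<zeta>'/\<zeta> = 1 / (s - 1) - deriv zeta_reg s / zeta_reg s\<close>
  with the denominators cleared, so that it can be stated before \<open>zeta_reg\<close> is known
  not to vanish.\<close>

lemma mangoldt_series_zeta_reg:
  assumes s: "Re s > 1"
  shows "(s - 1) * mangoldt_series s * zeta_reg s = zeta_reg s - (s - 1) * deriv zeta_reg s"
proof -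
  define Z where "Z = (\<lambda>s. \<Sum>n. of_nat n powr (-s) :: complex)"
  define D where "D = (\<Sum>n. of_real (ln (real n)) * of_nat n powr (-s) :: complex)"
  have "summable (\<lambda>n. norm (of_real (ln (real n)) * of_nat n powr (-s) :: complex))"
    by (rule summable_comparison_test'[OF summable_ln_powr[OF s], of 1])
       (auto simp: norm_mult norm_powr_real_powr)
  from summable_sums[OF summable_norm_cancel[OF this]]
  have "(\<lambda>n. of_real (ln (real n)) * of_nat n powr (-s) :: complex) sums D"
    unfolding D_def .
  from sums_minus[OF this]
  have "(\<Sum>n. - of_real (ln (real n)) * of_nat n powr (-s)) = - D"
    by (simp only: sums_iff mult_minus_left)
  hence dZ: "(Z has_field_derivative - D) (at s)"
    using deriv_zeta[OF s] unfolding Z_def by simp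
  have "((\<lambda>s. (s - 1) * Z s) has_field_derivative Z s + (s - 1) * - D) (at s)"
    by (rule derivative_eq_intros dZ refl)+ (simp add: algebra_simps)
  hence "(zeta_reg has_field_derivative Z s + (s - 1) * - D) (at s)"
    by (rule has_field_derivative_transform_within_open[OF _ open_halfspace_Re_gt[of 1]])
       (use s in \<open>auto simp: zeta_reg_eq Z_def\<close>)
  hence d: "deriv zeta_reg s = Z s - (s - 1) * D" by (simp add: DERIV_imp_deriv)
  have "mangoldt_series s * Z s = D"
    using mangoldt_series_times_zeta[OF s] by (simp add: Z_def D_def)
  hence "(s - 1) * mangoldt_series s * ((s - 1) * Z s) = (s - 1) * ((s - 1) * D)"
    by (simp add: mult_ac)
  moreover have zr: "zeta_reg s = (s - 1) * Z s" using zeta_reg_eq[OF s] by (simp add: Z_def)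
  ultimately show ?thesis unfolding d zr by (simp add: algebra_simps)
qed

section \<open>Non-vanishing on the line with real part 1\<close>

text \<open>With \<open>m\<close> the order of vanishing at \<open>s\<close>, the function is
  \<open>(w - s) ^ m\<close> times a function without zeros near \<open>s\<close>, and its
  logarithmic derivative has residue \<open>m\<close>. The point \<open>z\<close> excludes that
  \<open>f\<close> vanishes identically.\<close>

lemma log_deriv_limit:
  assumes f: "f holomorphic_on S" "open S" "connected S" and s: "s \<in> S" and z: "z \<in> S" "f z \<noteq> 0"
  obtains m :: nat where "((\<lambda>w. (w - s) * (deriv f w / f w)) \<longlongrightarrow> of_nat m) (at s)"
    "f s = 0 \<Longrightarrow> m > 0" "\<forall>\<^sub>F w in at s. f w \<noteq> 0"
proof (cases "f s = 0")
  case False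
  have c: "isCont f s" "isCont (deriv f) s"
    using f s holomorphic_deriv[OF f(1,2)]
    by (meson continuous_on_eq_continuous_at holomorphic_on_imp_continuous_on)+
  have "((\<lambda>w. (w - s) * (deriv f w / f w)) \<longlongrightarrow> (s - s) * (deriv f s / f s)) (at s)"
    using c False by (intro tendsto_intros) (auto simp: isCont_def)
  moreover have "\<forall>\<^sub>F w in at s. f w \<noteq> 0"
    using c(1) False by (auto simp: isCont_def intro: tendsto_imp_eventually_ne)
  ultimately show ?thesis using that[of 0] False by simp
next
  case True
  have "\<not> f constant_on S" using True s z unfolding constant_on_def by metis
  from holomorphic_factor_zero_nonconstant[OF f s True this]
  obtain g r n where n: "0 < n" and r: "0 < r" "ball s r \<subseteq> S" and g: "g holomorphic_on ball s r"
    and fg: "\<And>w. w \<in> ball s r \<Longrightarrow> f w = (w - s) ^ n * g w" and gne: "\<And>w. w \<in> ball s r \<Longrightarrow> g w \<noteq> 0"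
    by metis
  have ev: "\<forall>\<^sub>F w in at s. w \<in> ball s r - {s}"
    using r(1) by (intro eventually_at_in_open) auto
  have eq: "(w - s) * (deriv f w / f w) = of_nat n + (w - s) * (deriv g w / g w)"
    if w: "w \<in> ball s r - {s}" for w
  proof -
    have "(g has_field_derivative deriv g w) (at w)"
      using w g by (intro holomorphic_derivI) auto
    hence "((\<lambda>w. (w - s) ^ n * g w) has_field_derivative
        of_nat n * (w - s) ^ (n - 1) * g w + (w - s) ^ n * deriv g w) (at w)"
      by (auto intro!: derivative_eq_intros)
    hence "(f has_field_derivative of_nat n * (w - s) ^ (n - 1) * g w + (w - s) ^ n * deriv g w) (at w)"
      by (rule has_field_derivative_transform_within_open[of _ _ _ "ball s r"]) (use w fg in auto)
    hence "deriv f w = of_nat n * (w - s) ^ (n - 1) * g w + (w - s) ^ n * deriv g w"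
      by (rule DERIV_imp_deriv)
    moreover have "(w - s) * (w - s) ^ (n - 1) = (w - s) ^ n" using n by (simp add: power_eq_if)
    ultimately have "(w - s) * deriv f w = of_nat n * (w - s) ^ n * g w + (w - s) * (w - s) ^ n * deriv g w"
      by (simp add: algebra_simps)
    moreover define P where "P = (w - s) ^ n"
    ultimately have "(w - s) * deriv f w / f w = (of_nat n * P * g w + (w - s) * P * deriv g w) / (P * g w)"
      using w fg[of w] by simp
    moreover have "P \<noteq> 0" "g w \<noteq> 0" using w gne[of w] by (auto simp: P_def)
    ultimately show ?thesis by (simp add: add_divide_distrib)
  qed
  have cg: "isCont g s" "isCont (deriv g) s"
    using g holomorphic_deriv[OF g] r(1)
    by (meson centre_in_ball continuous_on_eq_continuous_at holomorphic_on_imp_continuous_on open_ball)+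
  have "((\<lambda>w. of_nat n + (w - s) * (deriv g w / g w)) \<longlongrightarrow> of_nat n + (s - s) * (deriv g s / g s)) (at s)"
    using cg gne[of s] r(1) by (intro tendsto_intros) (auto simp: isCont_def)
  hence "((\<lambda>w. (w - s) * (deriv f w / f w)) \<longlongrightarrow> of_nat n) (at s)"
    by (subst tendsto_cong[OF eventually_mono[OF ev eq]]) auto
  moreover have "\<forall>\<^sub>F w in at s. f w \<noteq> 0"
    using ev by eventually_elim (use fg gne in auto)
  ultimately show ?thesis using that[of n] n by simp
qed

text \<open>Here \<open>m\<close> is the order of vanishing of \<open>zeta_reg\<close> at \<open>s\<close>.\<close>
lemma mangoldt_series_limit:
  assumes s: "Re s \<ge> 1"
  obtains m :: nat where
    "((\<lambda>e. of_real e * mangoldt_series (s + of_real e)) \<longlongrightarrow> (if s = 1 then 1 else 0) - of_nat m) (at_right 0)"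
    "zeta_reg s = 0 \<longleftrightarrow> m > 0"
proof -
  have cv: "connected {s. Re s > 0}" by (intro convex_connected convex_halfspace_Re_gt)
  have one: "1 \<in> {s. Re s > 0}" "zeta_reg 1 \<noteq> 0" by auto
  obtain m where m: "((\<lambda>w. (w - s) * (deriv zeta_reg w / zeta_reg w)) \<longlongrightarrow> of_nat m) (at s)"
    "zeta_reg s = 0 \<Longrightarrow> m > 0" "\<forall>\<^sub>F w in at s. zeta_reg w \<noteq> 0"
    using log_deriv_limit[OF zeta_reg_holomorphic open_halfspace_Re_gt cv _ one, of s] s by auto
  \<comment> \<open>The point is approached horizontally from the right, where the real part exceeds
    1 and the Dirichlet series represents the logarithmic derivative.\<close>
  have flt: "filterlim (\<lambda>e::real. s + of_real e) (at s) (at_right 0)"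
    unfolding filterlim_at
    by (auto intro!: tendsto_eq_intros simp: eventually_at_filter)
  have lim1: "((\<lambda>e. of_real e * (deriv zeta_reg (s + of_real e) / zeta_reg (s + of_real e))) \<longlongrightarrow> of_nat m) (at_right 0)"
    using filterlim_compose[OF m(1) flt] by simp
  have lim2: "((\<lambda>e. of_real e / (s + of_real e - 1)) \<longlongrightarrow> (if s = 1 then 1 else 0)) (at_right (0::real))"
  proof (cases "s = 1")
    case True
    have "\<forall>\<^sub>F e in at_right (0::real). (1::complex) = of_real e / (s + of_real e - 1)"
      using eventually_at_right_less[of "0::real"] by eventually_elim (simp add: True)
    thus ?thesis using True by (simp add: tendsto_eventually eventually_mono)
  next
    case False
    have "((\<lambda>e. of_real e / (s + of_real e - 1)) \<longlongrightarrow> of_real 0 / (s + of_real 0 - 1)) (at_right (0::real))"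
      using False by (intro tendsto_intros) auto
    thus ?thesis using False by simp
  qed
  have "\<forall>\<^sub>F e in at_right 0. of_real e / (s + of_real e - 1)
      - of_real e * (deriv zeta_reg (s + of_real e) / zeta_reg (s + of_real e))
      = of_real e * mangoldt_series (s + of_real e)"
    using eventually_compose_filterlim[OF m(3) flt] eventually_at_right_less[of "0::real"]
  proof eventually_elim
    case (elim e)
    define w where "w = s + of_real e"
    have w: "Re w > 1" using elim s by (simp add: w_def)
    hence "w - 1 \<noteq> 0" by auto
    hence eq: "mangoldt_series w = 1 / (w - 1) - deriv zeta_reg w / zeta_reg w"
      using mangoldt_series_zeta_reg[OF w] elim(1) unfolding w_def[symmetric]
      by (simp add: field_simps)
    show ?case unfolding w_def[symmetric] eq by (simp add: right_diff_distrib)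
  qed
  from tendsto_cong[OF this] tendsto_diff[OF lim2 lim1]
  have lim: "((\<lambda>e. of_real e * mangoldt_series (s + of_real e)) \<longlongrightarrow> (if s = 1 then 1 else 0) - of_nat m) (at_right 0)"
    by simp
  have "zeta_reg s \<noteq> 0 \<Longrightarrow> m = 0"
  proof -
    assume ne: "zeta_reg s \<noteq> 0"
    have c: "isCont zeta_reg s" "isCont (deriv zeta_reg) s"
      using zeta_reg_holomorphic holomorphic_deriv[OF zeta_reg_holomorphic open_halfspace_Re_gt] s
      by (auto intro!: continuous_on_interior[of "{s. Re s > 0}"] holomorphic_on_imp_continuous_on
          simp: interior_open open_halfspace_Re_gt)
    have "((\<lambda>w. (w - s) * (deriv zeta_reg w / zeta_reg w)) \<longlongrightarrow> (s - s) * (deriv zeta_reg s / zeta_reg s)) (at s)"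
      using c ne by (intro tendsto_intros) (auto simp: isCont_def)
    with m(1) show "m = 0" using tendsto_unique[OF at_neq_bot] by force
  qed
  with lim m(2) show ?thesis using that by blast
qed

lemma norm_mangoldt_series_le:
  assumes x: "x > 1" "Re s \<ge> x"
  shows "norm (mangoldt_series s) \<le> (\<Sum>n. mangoldt n * real n powr (-x))"
proof -
  have sm: "summable (\<lambda>n. mangoldt n * real n powr (-x))"
    using summable_norm_mangoldt_series[of "of_real x"] x by (simp add: norm_mult norm_powr_real_powr abs_mult)
  have le: "norm (mangoldt n * of_nat n powr (-s) :: complex) \<le> mangoldt n * real n powr (-x)" for n
    using x by (cases "n = 0") (auto simp: norm_mult norm_powr_real_powr abs_mult mangoldt_nonneg intro!: mult_left_mono powr_mono)
  show ?thesis
    unfolding mangoldt_series_def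
    using le sm by (intro norm_suminf_le) auto
qed

text \<open>Termwise nonnegativity from
  \<open>3 + 4 * cos v + cos (2 * v) = 2 * (1 + cos v)^2\<close> and the nonnegativity of the von
  Mangoldt function.\<close>

lemma mangoldt_series_341:
  assumes x: "x > 1"
  shows "Re (3 * mangoldt_series (of_real x) + 4 * mangoldt_series (Complex x t)
     + mangoldt_series (Complex x (2 * t))) \<ge> 0"
proof -
  have sm: "(\<lambda>n. Re (mangoldt n * of_nat n powr (-s))) sums Re (mangoldt_series s)" if "Re s > 1" for s
    unfolding mangoldt_series_def
    by (intro sums_Re summable_sums summable_norm_cancel[OF summable_norm_mangoldt_series[OF that]])
  have Re: "Re (mangoldt n * of_nat n powr (- Complex x u)) = mangoldt n * real n powr (-x) * cos (u * ln (real n))" for n u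
  proof (cases "n = 0")
    case False
    have "Re (of_nat n powr (- Complex x u)) = real n powr (-x) * cos (u * ln (real n))"
      using False by (simp add: powr_def Re_exp Ln_of_nat)
    moreover have "Re (mangoldt n * z) = mangoldt n * Re z" for z :: complex by simp
    ultimately show ?thesis by (metis mult.assoc)
  qed auto
  have "(\<lambda>n. 3 * Re (mangoldt n * of_nat n powr (- of_real x)) + 4 * Re (mangoldt n * of_nat n powr (- Complex x t))
      + Re (mangoldt n * of_nat n powr (- Complex x (2 * t)))) sums
      (3 * Re (mangoldt_series (of_real x)) + 4 * Re (mangoldt_series (Complex x t))
        + Re (mangoldt_series (Complex x (2 * t))))"
    using x by (intro sums_add sums_mult sm) auto
  moreover have "3 * Re (mangoldt n * of_nat n powr (- of_real x)) + 4 * Re (mangoldt n * of_nat n powr (- Complex x t))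
      + Re (mangoldt n * of_nat n powr (- Complex x (2 * t))) \<ge> 0" for n
  proof -
    define v where "v = t * ln (real n)"
    have "3 + 4 * cos v + cos (2 * v) = 2 * (1 + cos v)\<^sup>2"
      unfolding cos_double_cos by (simp add: power2_eq_square algebra_simps)
    hence "mangoldt n * real n powr (-x) * (3 + 4 * cos v + cos (2 * v)) \<ge> 0"
      by (simp add: mangoldt_nonneg)
    moreover have Re0: "Re (mangoldt n * of_nat n powr (- of_real x)) = mangoldt n * real n powr (-x)"
      using Re[of n 0] by (simp add: complex_of_real_def)
    ultimately show ?thesis unfolding Re Re0 by (simp add: v_def algebra_simps)
  qed
  ultimately have "3 * Re (mangoldt_series (of_real x)) + 4 * Re (mangoldt_series (Complex x t))
        + Re (mangoldt_series (Complex x (2 * t))) \<ge> 0"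
    by (rule sums_le[OF _ sums_zero, rotated])
  thus ?thesis by simp
qed

text \<open>For \<open>Re s > 1\<close> the Dirichlet series stays bounded near \<open>s\<close>,
  which forces the order of vanishing to be 0. On the line \<open>Re s = 1\<close> the 3-4-1
  inequality, multiplied by \<open>e\<close> and taken to the limit, says
  \<open>3 * (1 - m0) - 4 * m1 - m2 \<ge> 0\<close> for the orders at \<open>1\<close>,
  \<open>s\<close> and \<open>1 + 2it\<close>; a zero at \<open>s\<close> means
  \<open>m1 \<ge> 1\<close> and makes the left side negative.\<close>

lemma zeta_reg_nonzero:
  assumes s: "Re s \<ge> 1"
  shows "zeta_reg s \<noteq> 0"
proof (cases "Re s > 1")
  case True
  obtain m where m: "((\<lambda>e. of_real e * mangoldt_series (s + of_real e)) \<longlongrightarrow> (if s = 1 then 1 else 0) - of_nat m) (at_right 0)"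
    "zeta_reg s = 0 \<longleftrightarrow> m > 0"
    using mangoldt_series_limit[OF s] by metis
  define B where "B = (\<Sum>n. mangoldt n * real n powr (- Re s))"
  have "((\<lambda>e. of_real e * mangoldt_series (s + of_real e)) \<longlongrightarrow> 0) (at_right 0)"
  proof (rule Lim_null_comparison)
    show "\<forall>\<^sub>F e in at_right 0. norm (of_real e * mangoldt_series (s + of_real e)) \<le> e * B"
      using eventually_at_right_less[of "0::real"]
    proof eventually_elim
      case (elim e)
      thus ?case using norm_mangoldt_series_le[OF True, of "s + of_real e"]
        by (simp add: norm_mult B_def)
    qed
    have "((\<lambda>e. e * B) \<longlongrightarrow> 0 * B) (at_right 0)" by (intro tendsto_intros)
    thus "((\<lambda>e. e * B) \<longlongrightarrow> 0) (at_right 0)" by simp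
  qed
  with m(1) have "(if s = 1 then 1 else 0) - of_nat m = (0::complex)"
    using tendsto_unique[OF trivial_limit_at_right_real] by blast
  moreover have "s \<noteq> 1" using True by auto
  ultimately show ?thesis using m(2) by auto
next
  case False
  hence s1: "Re s = 1" using s by simp
  define t where "t = Im s"
  have s_eq: "s = Complex 1 t" using s1 by (simp add: t_def complex_eq_iff)
  show ?thesis
  proof
    assume z: "zeta_reg s = 0"
    hence t0: "t \<noteq> 0" using zeta_reg_1 s_eq by (metis complex_of_real_def of_real_1 zero_neq_one)
    obtain m0 where m0: "((\<lambda>e. of_real e * mangoldt_series (1 + of_real e)) \<longlongrightarrow> 1 - of_nat m0) (at_right 0)"
      "zeta_reg 1 = 0 \<longleftrightarrow> m0 > 0"
      using mangoldt_series_limit[of 1] by auto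
    obtain m1 where m1: "((\<lambda>e. of_real e * mangoldt_series (s + of_real e)) \<longlongrightarrow> - of_nat m1) (at_right 0)"
      "zeta_reg s = 0 \<longleftrightarrow> m1 > 0"
      using mangoldt_series_limit[of s] s t0 s_eq by (auto simp: complex_eq_iff)
    obtain m2 where m2: "((\<lambda>e. of_real e * mangoldt_series (Complex 1 (2 * t) + of_real e)) \<longlongrightarrow> - of_nat m2) (at_right 0)"
      using mangoldt_series_limit[of "Complex 1 (2 * t)"] t0 by (auto simp: complex_eq_iff)
    have "((\<lambda>e. Re (3 * (of_real e * mangoldt_series (1 + of_real e))
        + 4 * (of_real e * mangoldt_series (s + of_real e))
        + of_real e * mangoldt_series (Complex 1 (2 * t) + of_real e)))
        \<longlongrightarrow> Re (3 * (1 - of_nat m0) + 4 * (- of_nat m1) + - of_nat m2)) (at_right 0)"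
      by (intro tendsto_intros m0 m1 m2)
    moreover have "\<forall>\<^sub>F e in at_right 0. Re (3 * (of_real e * mangoldt_series (1 + of_real e))
        + 4 * (of_real e * mangoldt_series (s + of_real e))
        + of_real e * mangoldt_series (Complex 1 (2 * t) + of_real e)) \<ge> 0"
      using eventually_at_right_less[of "0::real"]
    proof eventually_elim
      case (elim e)
      have eq: "1 + of_real e = complex_of_real (1 + e)" "s + of_real e = Complex (1 + e) t"
        "Complex 1 (2 * t) + of_real e = Complex (1 + e) (2 * t)"
        by (simp_all add: s_eq complex_eq_iff)
      have "Re (3 * (of_real e * mangoldt_series (1 + of_real e))
        + 4 * (of_real e * mangoldt_series (s + of_real e))
        + of_real e * mangoldt_series (Complex 1 (2 * t) + of_real e))
        = e * Re (3 * mangoldt_series (of_real (1 + e)) + 4 * mangoldt_series (Complex (1 + e) t)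
     + mangoldt_series (Complex (1 + e) (2 * t)))"
        unfolding eq by (simp add: algebra_simps)
      thus ?case using mangoldt_series_341[of "1 + e" t] elim by simp
    qed
    ultimately have "Re (3 * (1 - of_nat m0) + 4 * (- of_nat m1) + - of_nat m2) \<ge> 0"
      by (intro tendsto_lowerbound[where F = "at_right (0::real)"]) auto
    moreover have "m1 \<ge> 1" using m1(2) z by simp
    ultimately show False by simp
  qed
qed

section \<open>The Chebyshev function\<close>

definition chebyshev_psi :: "nat \<Rightarrow> real" where
  "chebyshev_psi n = (\<Sum>d=1..n. mangoldt d)"

lemma chebyshev_psi_Suc: "chebyshev_psi (Suc n) = chebyshev_psi n + mangoldt (Suc n)"
  by (simp add: chebyshev_psi_def)

lemma chebyshev_psi_mono: "m \<le> n \<Longrightarrow> chebyshev_psi m \<le> chebyshev_psi n"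
  unfolding chebyshev_psi_def by (intro sum_mono2) (auto simp: mangoldt_nonneg)

lemma chebyshev_psi_nonneg: "chebyshev_psi n \<ge> 0"
  unfolding chebyshev_psi_def by (intro sum_nonneg) (auto simp: mangoldt_nonneg)

text \<open>From \<open>n\<close> to \<open>Suc n\<close> the quotient \<open>n div d\<close> rises
  by one exactly when \<open>d\<close> divides \<open>Suc n\<close>, and the weights of these
  divisors add up to \<open>ln (Suc n)\<close>.\<close>

lemma ln_fact_mangoldt: "ln (fact n :: real) = (\<Sum>d=1..n. mangoldt d * real (n div d))"
proof (induction n)
  case (Suc n)
  have "(\<Sum>d=1..Suc n. mangoldt d * real (Suc n div d))
      = (\<Sum>d=1..Suc n. mangoldt d * real (n div d) + (if d dvd Suc n then mangoldt d else 0))"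
    by (intro sum.cong) (auto simp: div_Suc dvd_eq_mod_eq_0 algebra_simps)
  also have "\<dots> = (\<Sum>d=1..Suc n. mangoldt d * real (n div d))
      + (\<Sum>d=1..Suc n. if d dvd Suc n then mangoldt d else 0)"
    by (rule sum.distrib)
  also have "(\<Sum>d=1..Suc n. mangoldt d * real (n div d)) = ln (fact n)"
    using Suc.IH by simp
  also have "(\<Sum>d=1..Suc n. if d dvd Suc n then mangoldt d else 0) = (\<Sum>d | d dvd Suc n. mangoldt d :: real)"
    using dvd_imp_le[of _ "Suc n"] dvd_pos_nat[of "Suc n"]
    by (intro sum.mono_neutral_cong_right) (auto simp: Suc_le_eq)
  also have "\<dots> = ln (real (Suc n))"
    using mangoldt_sum[of "Suc n", where ?'a = real] by simp
  finally show ?case by (simp add: ln_mult add.commute del: of_nat_Suc)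
qed simp

text \<open>The logarithm of the central binomial coefficient is a sum of \<open>mangoldt d\<close>
  with coefficients \<open>2 * n div d - 2 * (n div d)\<close>. These are never negative and are at
  least 1 for \<open>n < d \<le> 2 * n\<close>, while the coefficient itself is at most
  \<open>2 ^ (2 * n)\<close>.\<close>

lemma chebyshev_psi_double: "chebyshev_psi (2 * n) - chebyshev_psi n \<le> 2 * real n * ln 2"
proof -
  have "ln (fact (2 * n) :: real) - 2 * ln (fact n) = ln (real ((2 * n) choose n))"
  proof -
    have "real ((2 * n) choose n) = fact (2 * n) / (fact n * fact n)"
      by (simp add: binomial_fact mult_2)
    thus ?thesis by (simp add: ln_div ln_mult)
  qed
  also have "\<dots> \<le> ln (2 ^ (2 * n))"
  proof -
    have "real ((2 * n) choose n) \<le> real (2 ^ (2 * n))"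
      by (simp only: of_nat_le_iff binomial_le_pow2)
    moreover have "real ((2 * n) choose n) > 0" by (simp add: zero_less_binomial)
    ultimately show ?thesis by (subst ln_le_cancel_iff) auto
  qed
  also have "\<dots> = 2 * real n * ln 2" by (subst ln_realpow) auto
  finally have upper: "ln (fact (2 * n) :: real) - 2 * ln (fact n) \<le> 2 * real n * ln 2" .
  have "ln (fact n :: real) = (\<Sum>d=1..2*n. mangoldt d * real (n div d))"
    unfolding ln_fact_mangoldt by (intro sum.mono_neutral_left) auto
  hence eq: "ln (fact (2 * n) :: real) - 2 * ln (fact n)
     = (\<Sum>d=1..2*n. mangoldt d * (real (2 * n div d) - 2 * real (n div d)))"
    by (simp add: ln_fact_mangoldt sum_subtractf right_diff_distrib sum_distrib_left mult_ac)
  have "chebyshev_psi (2 * n) - chebyshev_psi n = (\<Sum>d=n+1..2*n. mangoldt d)"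
    using sum.ub_add_nat[of 1 n "mangoldt :: nat \<Rightarrow> real" n] by (simp add: chebyshev_psi_def mult_2)
  also have "\<dots> \<le> (\<Sum>d=n+1..2*n. mangoldt d * (real (2 * n div d) - 2 * real (n div d)))"
  proof (rule sum_mono)
    fix d assume d: "d \<in> {n+1..2*n}"
    hence "n div d = 0" "2 * n div d \<ge> 1" by (auto simp: div_greater_zero_iff Suc_le_eq)
    thus "mangoldt d \<le> (mangoldt d * (real (2 * n div d) - 2 * real (n div d)) :: real)"
      using mangoldt_nonneg[of d] by (simp add: mult_le_cancel_left1 del: of_nat_div)
  qed
  also have "\<dots> \<le> (\<Sum>d=1..2*n. mangoldt d * (real (2 * n div d) - 2 * real (n div d)))"
  proof (intro sum_mono2 mult_nonneg_nonneg mangoldt_nonneg)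
    fix d assume "d \<in> {1..2*n} - {n+1..2*n}"
    hence "2 * (n div d) \<le> 2 * n div d"
      using div_times_less_eq_dividend[of n d] by (simp add: less_eq_div_iff_mult_less_eq)
    hence "real (2 * (n div d)) \<le> real (2 * n div d)" by (simp only: of_nat_le_iff)
    thus "0 \<le> real (2 * n div d) - 2 * real (n div d)" by simp
  qed auto
  finally show ?thesis using upper eq by linarith
qed

text \<open>Induction by halving: doubling \<open>m\<close> costs at most \<open>2 * m\<close>,
  which turns \<open>4 * m\<close> into \<open>6 * m\<close> and leaves \<open>2 * m\<close> for the
  additional term when \<open>n\<close> is odd.\<close>

lemma chebyshev_psi_le: "chebyshev_psi n \<le> 4 * real n"
proof (induction n rule: less_induct)
  case (less n)
  show ?case
  proof (cases "n \<le> 1")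
    case True
    thus ?thesis by (auto simp: le_Suc_eq chebyshev_psi_def)
  next
    case False
    define m where "m = n div 2"
    have m: "m < n" "n = 2 * m \<or> n = 2 * m + 1" using False by (auto simp: m_def)
    have l2: "ln 2 \<le> (1::real)" using ln_le_minus_one[of 2] by simp
    have "2 * real m * ln 2 \<le> 2 * real m * 1" by (intro mult_left_mono l2) auto
    hence dbl: "chebyshev_psi (2 * m) \<le> 6 * real m"
      using chebyshev_psi_double[of m] less[OF m(1)] by linarith
    have "ln (real (2 * m + 1)) \<le> 2 * real m" using ln_le_minus_one[of "real (2 * m + 1)"] by simp
    hence "chebyshev_psi (2 * m + 1) \<le> 8 * real m"
      using dbl chebyshev_psi_Suc[of "2 * m"] mangoldt_le_ln[of "2 * m + 1"] by (simp del: of_nat_Suc of_nat_add)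
    thus ?thesis using m(2) dbl by auto
  qed
qed

section \<open>Newman's theorem applied to the Chebyshev function\<close>

text \<open>Entire because the singularity at \<open>s = 0\<close>, a point inside Newman's contour, has been removed.\<close>
definition power_gap :: "nat \<Rightarrow> complex \<Rightarrow> complex" where
  "power_gap n s = (if s = 0 then deriv (\<lambda>s. of_nat n powr (-s) - of_nat (Suc n) powr (-s)) 0
     else (of_nat n powr (-s) - of_nat (Suc n) powr (-s)) / s)"

lemma power_gap_holomorphic:
  assumes "n > 0"
  shows "power_gap n holomorphic_on A"
proof -
  define f :: "complex \<Rightarrow> complex" where "f = (\<lambda>s. of_nat n powr (-s) - of_nat (Suc n) powr (-s))"
  have "f holomorphic_on UNIV" unfolding f_def by (intro holomorphic_intros)
  from pole_lemma_open[OF this, of 0]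
  have "(\<lambda>s. if s = 0 then deriv f 0 else (f s - f 0) / (s - 0)) holomorphic_on UNIV" by simp
  moreover have f0: "f 0 = 0" using assms by (simp add: f_def del: of_nat_Suc)
  have "power_gap n = (\<lambda>s. if s = 0 then deriv f 0 else (f s - f 0) / (s - 0))"
    unfolding fun_eq_iff f0 by (simp add: power_gap_def f_def del: of_nat_Suc)
  ultimately have "power_gap n holomorphic_on UNIV" by simp
  thus ?thesis using holomorphic_on_subset by blast
qed

lemma power_gap_1: "n > 0 \<Longrightarrow> power_gap n 1 = of_real (1 / real n - 1 / real (Suc n))"
  by (simp add: power_gap_def powr_minus inverse_eq_divide del: of_nat_Suc)

text \<open>Moving the factor \<open>n \<le> t\<close> under the derivative lowers the decay to
  \<open>t powr (-x - 1)\<close>, whose primitive is explicit. The resulting bound telescopes over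
  \<open>n\<close>, and it holds for both signs of \<open>x\<close>, as the two half-planes of
  Newman's theorem require.\<close>

lemma powr_diff_bound:
  assumes n: "n > 0" and x: "x \<noteq> 0" "Re s = x + 1"
  shows "real n * norm (of_nat n powr (-s) - of_nat (Suc n) powr (-s) :: complex)
         \<le> norm s * ((real n powr (-x) - real (Suc n) powr (-x)) / x)"
proof -
  define f where "f = (\<lambda>t::real. of_nat n * (of_real t :: complex) powr (-s))"
  define \<phi> where "\<phi> = (\<lambda>t::real. norm s * (- (t powr (-x)) / x))"
  have df: "(f has_vector_derivative of_nat n * (-s * of_real t powr (-s - 1))) (at t within A)" if "t > 0" for t A
    unfolding f_def
    using that by (intro has_vector_derivative_mult_right has_vector_derivative_real_field has_field_derivative_powr) auto
  have dphi: "(\<phi> has_vector_derivative norm s * t powr (-x - 1)) (at t within A)" if "t > 0" for t A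
    unfolding \<phi>_def has_real_derivative_iff_has_vector_derivative[symmetric]
    using that x by (auto intro!: derivative_eq_intros simp: powr_diff powr_minus field_simps)
  have "norm (f (real (Suc n)) - f (real n)) \<le> \<phi> (real (Suc n)) - \<phi> (real n)"
  proof (rule differentiable_bound_general[where f' = "\<lambda>t. of_nat n * (-s * of_real t powr (-s - 1))" and \<phi>' = "\<lambda>t. norm s * t powr (-x - 1)"])
    show "continuous_on {real n..real (Suc n)} f" "continuous_on {real n..real (Suc n)} \<phi>"
      by (rule continuous_on_vector_derivative, rule df dphi, use n in auto)+
    fix t assume t: "real n < t" "t < real (Suc n)"
    hence t0: "t > 0" using n by simp
    have Re: "Re (-s - 1) = -x - 2" using x by simp
    have "norm (complex_of_real t powr (-s - 1)) = t powr (-x - 2)"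
      unfolding Re[symmetric] using t0 by (subst norm_powr_real_powr) auto
    hence "norm (of_nat n * (-s * of_real t powr (-s - 1))) = real n * (norm s * t powr (-x - 2))"
      by (simp add: norm_mult)
    also have "\<dots> \<le> t * (norm s * t powr (-x - 2))"
      using t by (intro mult_right_mono) auto
    also have "\<dots> = norm s * (t powr 1 * t powr (-x - 2))" using t0 by simp
    also have "t powr 1 * t powr (-x - 2) = t powr (-x - 1)"
      by (subst powr_add[symmetric], rule arg_cong[where f = "(powr) t"]) simp
    finally show "norm (of_nat n * (-s * of_real t powr (-s - 1))) \<le> norm s * t powr (-x - 1)" .
  qed (use n df dphi in auto)
  also have "\<phi> (real (Suc n)) - \<phi> (real n) = norm s * ((real n powr (-x) - real (Suc n) powr (-x)) / x)"
    by (simp add: \<phi>_def diff_divide_distrib right_diff_distrib)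
  also have "f (real (Suc n)) - f (real n) = of_nat n * (of_nat (Suc n) powr (-s) - of_nat n powr (-s))"
    by (simp add: f_def right_diff_distrib)
  finally show ?thesis by (simp add: norm_mult norm_minus_commute)
qed

lemma power_gap_bound:
  assumes n: "n > 0" and x: "x \<noteq> 0" "Re s = x + 1"
  shows "real n * norm (power_gap n s) \<le> (real n powr (-x) - real (Suc n) powr (-x)) / x"
proof (cases "s = 0")
  case False
  have eq: "norm s * (real n * norm (power_gap n s)) = real n * norm (of_nat n powr (-s) - of_nat (Suc n) powr (-s) :: complex)"
    using False by (simp add: power_gap_def norm_divide)
  have "norm s * (real n * norm (power_gap n s)) \<le> norm s * ((real n powr (-x) - real (Suc n) powr (-x)) / x)"
    unfolding eq by (rule powr_diff_bound[OF assms])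
  thus ?thesis by (rule mult_left_le_imp_le) (use False in simp)
next
  case True
  \<comment> \<open>At the removed singularity the value is \<open>ln ((n + 1) / n)\<close>, and the
    right-hand side of the claim is 1.\<close>
  hence x1: "x = -1" using x by simp
  have d: "((\<lambda>s. of_nat k powr (-s) :: complex) has_field_derivative - of_real (ln (real k))) (at 0)" if "k > 0" for k
    using DERIV_chain2[OF has_field_derivative_powr_right[of "of_nat k" "-0"] DERIV_minus[OF DERIV_ident]] that
    by simp
  have "power_gap n s = deriv (\<lambda>s. of_nat n powr (-s) - of_nat (Suc n) powr (-s)) 0"
    using True by (simp add: power_gap_def)
  also have "\<dots> = - of_real (ln (real n)) - - of_real (ln (real (Suc n)))"
    by (intro DERIV_imp_deriv DERIV_diff d n) auto
  also have "\<dots> = of_real (ln (real (Suc n) / real n))"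
    using n by (simp add: ln_div del: of_nat_Suc)
  finally have "norm (power_gap n s) = ln (real (Suc n) / real n)" using n by (simp add: field_simps)
  also have "\<dots> \<le> 1 / real n" using n ln_add_one_self_le_self[of "1 / real n"] by (simp add: add_divide_distrib add.commute)
  finally show ?thesis using n by (simp add: x1 field_simps)
qed

lemma psi_term_bound:
  assumes n: "n > 0" and x: "x \<noteq> 0" "Re s = x + 1"
  shows "norm (of_real (chebyshev_psi n - real n) * power_gap n s)
    \<le> 4 * ((real n powr (-x) - real (Suc n) powr (-x)) / x)"
proof -
  have "\<bar>chebyshev_psi n - real n\<bar> \<le> 4 * real n"
    using chebyshev_psi_le[of n] chebyshev_psi_nonneg[of n] by linarith
  hence "norm (of_real (chebyshev_psi n - real n) * power_gap n s) \<le> 4 * real n * norm (power_gap n s)"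
    unfolding norm_mult norm_of_real by (intro mult_right_mono) auto
  also have "\<dots> \<le> 4 * ((real n powr (-x) - real (Suc n) powr (-x)) / x)"
    using mult_left_mono[OF power_gap_bound[OF assms], of 4] by (simp only: mult.assoc)
  finally show ?thesis .
qed

text \<open>Summation by parts, \<open>chebyshev_psi n - n\<close> being the partial sums of
  \<open>mangoldt n - 1\<close>. The index 0 on the right adds nothing since
  \<open>0 powr (-s) = 0\<close>.\<close>

lemma abel_summation_psi:
  assumes "N > 0"
  shows "(\<Sum>n=1..<N. of_real (chebyshev_psi n - real n) * (of_nat n powr (-s) - of_nat (Suc n) powr (-s)))
   = (\<Sum>n<Suc N. (mangoldt n - 1) * of_nat n powr (-s) :: complex)
     - of_real (chebyshev_psi N - real N) * of_nat N powr (-s)"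
  using assms
proof (induction N rule: nat_induct_non_zero)
  case (Suc n)
  show ?case using Suc.IH Suc.hyps
    by (simp add: chebyshev_psi_Suc algebra_simps del: of_nat_Suc) (simp add: algebra_simps)
qed (auto simp: chebyshev_psi_def)

text \<open>Holomorphic continuation of \<open>- \<zeta>'/\<zeta> - \<zeta>\<close>, in which the poles at \<open>s = 1\<close> cancel.\<close>
definition zeta_defect :: "complex \<Rightarrow> complex" where
  "zeta_defect s = - (if s = 1 then deriv zeta_reg 1 else (zeta_reg s - zeta_reg 1) / (s - 1))
     - deriv zeta_reg s / zeta_reg s"

lemma zeta_defect_eq:
  assumes s: "Re s > 1"
  shows "zeta_defect s = mangoldt_series s - (\<Sum>n. of_nat n powr (-s))"
proof -
  have ne: "s - 1 \<noteq> 0" "zeta_reg s \<noteq> 0" using s zeta_reg_nonzero[of s] by auto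
  have "mangoldt_series s = 1 / (s - 1) - deriv zeta_reg s / zeta_reg s"
    using mangoldt_series_zeta_reg[OF s] ne by (simp add: field_simps)
  moreover have "(\<Sum>n. of_nat n powr (-s)) = zeta_reg s / (s - 1)"
    using zeta_reg_eq[OF s] ne by simp
  ultimately show ?thesis using ne by (simp add: zeta_defect_def diff_divide_distrib)
qed

lemma psi_terms_sums:
  assumes s: "Re s > 1"
  shows "(\<lambda>N. \<Sum>n=1..<N. of_real (chebyshev_psi n - real n) * power_gap n s) \<longlonglongrightarrow> zeta_defect s / s"
proof -
  have s0: "s \<noteq> 0" using s by auto
  have "(\<lambda>n. mangoldt n * of_nat n powr (-s) - of_nat n powr (-s)) sums zeta_defect s"
    unfolding zeta_defect_eq[OF s] mangoldt_series_def
    by (intro sums_diff summable_sums summable_zeta[OF s] summable_norm_cancel[OF summable_norm_mangoldt_series[OF s]])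
  hence "(\<lambda>n. (mangoldt n - 1) * of_nat n powr (-s)) sums zeta_defect s"
    by (simp add: left_diff_distrib)
  hence "(\<lambda>N. \<Sum>n<Suc N. (mangoldt n - 1) * of_nat n powr (-s)) \<longlonglongrightarrow> zeta_defect s"
    unfolding sums_def by (rule LIMSEQ_Suc)
  moreover have "(\<lambda>N. of_real (chebyshev_psi N - real N) * of_nat N powr (-s) :: complex) \<longlonglongrightarrow> 0"
  proof (rule Lim_null_comparison)
    show "\<forall>\<^sub>F N in sequentially. norm (of_real (chebyshev_psi N - real N) * of_nat N powr (-s) :: complex)
        \<le> 4 * real N * real N powr (- Re s)"
    proof (intro always_eventually allI)
      fix N
      have "\<bar>chebyshev_psi N - real N\<bar> \<le> 4 * real N"
        using chebyshev_psi_le[of N] chebyshev_psi_nonneg[of N] by linarith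
      thus "norm (of_real (chebyshev_psi N - real N) * of_nat N powr (-s) :: complex) \<le> 4 * real N * real N powr (- Re s)"
        unfolding norm_mult norm_of_real by (intro mult_mono) (auto simp: norm_powr_real_powr)
    qed
    show "(\<lambda>N. 4 * real N * real N powr (- Re s)) \<longlonglongrightarrow> 0" using s by real_asymp
  qed
  ultimately have "(\<lambda>N. (\<Sum>n<Suc N. (mangoldt n - 1) * of_nat n powr (-s))
      - of_real (chebyshev_psi N - real N) * of_nat N powr (-s)) \<longlonglongrightarrow> zeta_defect s - 0"
    by (rule tendsto_diff)
  from this[unfolded diff_zero]
  have "(\<lambda>N. \<Sum>n=1..<N. of_real (chebyshev_psi n - real n) * (of_nat n powr (-s) - of_nat (Suc n) powr (-s))) \<longlonglongrightarrow> zeta_defect s"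
    by (rule Lim_transform_eventually)
       (rule eventually_mono[OF eventually_gt_at_top[of 0]], simp only: abel_summation_psi)
  hence "(\<lambda>N. (\<Sum>n=1..<N. of_real (chebyshev_psi n - real n) * (of_nat n powr (-s) - of_nat (Suc n) powr (-s))) / s) \<longlonglongrightarrow> zeta_defect s / s"
    by (intro tendsto_divide tendsto_const s0)
  thus ?thesis using s0 by (simp add: power_gap_def sum_divide_distrib del: of_nat_Suc)
qed

lemma psi_sum_convergent:
  "convergent (\<lambda>N. \<Sum>n=1..<N. (chebyshev_psi n - real n) * (1 / real n - 1 / real (Suc n)))"
proof -
  define S where "S = (\<lambda>N w. \<Sum>n=1..<N. of_real (chebyshev_psi n - real n) * power_gap n (w + 1))"
  define F where "F = (\<lambda>w. zeta_defect (w + 1) / (w + 1))"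
  \<comment> \<open>On \<open>V\<close> the function \<open>zeta_defect\<close> is holomorphic. By
    non-vanishing \<open>V\<close> contains \<open>Re s \<ge> 1\<close>, so its translate
    \<open>U\<close> contains \<open>Re w \<ge> 0\<close>.\<close>
  define V where "V = {s. Re s > 0} \<inter> {s. Re s > 0 \<and> zeta_reg s \<noteq> 0}"
  define U where "U = (\<lambda>w. w + 1) -` V"
  have telescope: "(\<Sum>n=M..<N. real n powr (-x) - real (Suc n) powr (-x)) = real M powr (-x) - real N powr (-x)"
    if "M \<le> N" for M N x
    using sum_Suc_diff'[OF that, of "\<lambda>n. - (real n powr (-x))"] by simp
  have V: "open V"
  proof -
    have "open ({s. Re s > 0} \<inter> zeta_reg -` (- {0}))"
      using zeta_reg_holomorphic
      by (intro continuous_open_preimage holomorphic_on_imp_continuous_on open_halfspace_Re_gt) auto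
    also have "{s. Re s > 0} \<inter> zeta_reg -` (- {0}) = V" by (auto simp: V_def)
    finally show ?thesis .
  qed
  hence U: "open U" unfolding U_def by (intro continuous_open_vimage continuous_intros)
  have sub: "{w. Re w \<ge> 0} \<subseteq> U"
    using zeta_reg_nonzero by (auto simp: U_def V_def)
  have "zeta_defect holomorphic_on V"
  proof -
    have z: "zeta_reg holomorphic_on V"
      by (rule holomorphic_on_subset[OF zeta_reg_holomorphic]) (auto simp: V_def)
    show ?thesis unfolding zeta_defect_def
      by (intro holomorphic_intros pole_lemma_open z V holomorphic_deriv[OF z V]) (auto simp: V_def)
  qed
  hence "(zeta_defect \<circ> (\<lambda>w. w + 1)) holomorphic_on U"
    by (intro holomorphic_on_compose_gen holomorphic_intros) (auto simp: U_def)
  hence F: "F holomorphic_on U"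
    unfolding F_def o_def by (intro holomorphic_intros) (auto simp: U_def V_def complex_eq_iff)
  have S: "S N holomorphic_on UNIV" for N
  proof -
    have "(power_gap n \<circ> (\<lambda>w. w + 1)) holomorphic_on UNIV" if "n > 0" for n
      by (intro holomorphic_on_compose holomorphic_intros power_gap_holomorphic that)
    thus ?thesis unfolding S_def o_def by (intro holomorphic_intros) auto
  qed
  have right: "norm (F w - S N w) \<le> 4 * real N powr (- Re w) / Re w" if N: "N \<ge> 1" and w: "Re w > 0" for N w
  proof -
    have "(\<lambda>M. S M w) \<longlonglongrightarrow> F w"
      unfolding S_def F_def using psi_terms_sums[of "w + 1"] w by simp
    hence lim: "(\<lambda>M. norm (S M w - S N w)) \<longlonglongrightarrow> norm (F w - S N w)"
      by (intro tendsto_intros)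
    \<comment> \<open>Telescoping bounds each finite piece of the tail uniformly in
      \<open>M\<close>; the bound on \<open>F w - S N w\<close> follows in the limit.\<close>
    have "norm (S M w - S N w) \<le> 4 * real N powr (- Re w) / Re w" if M: "M \<ge> N" for M
    proof -
      have "S M w - S N w = (\<Sum>n=N..<M. of_real (chebyshev_psi n - real n) * power_gap n (w + 1))"
        using sum.atLeastLessThan_concat[OF N M, of "\<lambda>n. of_real (chebyshev_psi n - real n) * power_gap n (w + 1)"]
        by (simp add: S_def algebra_simps)
      also have "norm \<dots> \<le> (\<Sum>n=N..<M. 4 * ((real n powr (- Re w) - real (Suc n) powr (- Re w)) / Re w))"
        using N w by (intro sum_norm_le psi_term_bound) auto
      also have "\<dots> = 4 * ((real N powr (- Re w) - real M powr (- Re w)) / Re w)"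
        by (simp only: sum_distrib_left[symmetric] sum_divide_distrib[symmetric] telescope[OF M])
      also have "\<dots> \<le> 4 * (real N powr (- Re w) / Re w)"
        using w by (intro mult_left_mono divide_right_mono) auto
      finally show ?thesis by simp
    qed
    with LIMSEQ_le_const2[OF lim] show ?thesis by blast
  qed
  have left: "norm (S N w) \<le> 4 * real N powr (- Re w) / (- Re w)" if N: "N \<ge> 1" and w: "Re w < 0" for N w
  proof -
    have "norm (S N w) \<le> (\<Sum>n=1..<N. 4 * ((real n powr (- Re w) - real (Suc n) powr (- Re w)) / Re w))"
      unfolding S_def using w by (intro sum_norm_le psi_term_bound) auto
    also have "\<dots> = 4 * ((real 1 powr (- Re w) - real N powr (- Re w)) / Re w)"
      by (simp only: sum_distrib_left[symmetric] sum_divide_distrib[symmetric] telescope[OF N])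
    also have "\<dots> = 4 * real N powr (- Re w) / (- Re w) - 4 / (- Re w)"
      using w by (simp add: field_simps)
    also have "\<dots> \<le> 4 * real N powr (- Re w) / (- Re w)" using w by (simp add: field_simps)
    finally show ?thesis .
  qed
  have "(\<lambda>N. S N 0) \<longlonglongrightarrow> F 0"
    by (rule newman_tauberian[OF U sub F S, of 4]) (use right left in auto)
  hence "(\<lambda>N. Re (S N 0)) \<longlonglongrightarrow> Re (F 0)" by (rule tendsto_Re)
  moreover have "Re (S N 0) = (\<Sum>n=1..<N. (chebyshev_psi n - real n) * (1 / real n - 1 / real (Suc n)))" for N
    unfolding S_def Re_sum by (intro sum.cong) (auto simp: power_gap_1 simp del: of_nat_Suc)
  ultimately show ?thesis by (auto simp: convergent_def)
qed

text \<open>Convergence alone suffices because \<open>chebyshev_psi\<close> is monotone: an excess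
  at \<open>M\<close> persists over a block of length proportional to \<open>M\<close>, where the
  weights are of order \<open>1 / M^2\<close>, so the block sum stays above a constant independent
  of \<open>M\<close>.\<close>

theorem chebyshev_psi_limsup:
  assumes e: "e > 0"
  shows "\<forall>\<^sub>F n in sequentially. chebyshev_psi n \<le> (1 + e) * real n"
proof -
  \<comment> \<open>The cap at 1 keeps the block below \<open>2 * M\<close>.\<close>
  define d where "d = min e 1"
  have d: "0 < d" "d \<le> 1" "d \<le> e" using e by (auto simp: d_def)
  define T where "T = (\<lambda>N. \<Sum>n=1..<N. (chebyshev_psi n - real n) * (1 / real n - 1 / real (Suc n)))"
  have "Cauchy T" using psi_sum_convergent unfolding T_def Cauchy_convergent_iff .
  \<comment> \<open>A block of at least \<open>d * M / 4\<close> integers with terms at least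
    \<open>(d / 2 * M) * (1 / (4 * M^2))\<close> adds up to \<open>d^2 / 32\<close>.\<close>
  moreover have "d\<^sup>2 / 32 > 0" using d by simp
  ultimately obtain M0 where M0: "\<And>m n. m \<ge> M0 \<Longrightarrow> n \<ge> M0 \<Longrightarrow> norm (T m - T n) < d\<^sup>2 / 32"
    unfolding Cauchy_iff by metis
  \<comment> \<open>For \<open>M \<ge> 4 / d\<close> the loss of 1 from rounding \<open>K\<close>
    down is at most \<open>d * M / 4\<close>, half of the intended block length.\<close>
  define M1 where "M1 = nat \<lceil>4 / d\<rceil>"
  have "chebyshev_psi M \<le> (1 + e) * real M" if M: "M \<ge> max M0 (max M1 1)" for M
  proof (rule ccontr)
    assume "\<not> ?thesis"
    moreover have "d * real M \<le> e * real M" using d by (intro mult_right_mono) auto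
    ultimately have big: "chebyshev_psi M > real M + d * real M" by (simp add: algebra_simps)
    have M_ge: "M \<ge> M0" "M \<ge> 1" "real M \<ge> 4 / d"
      using M by (auto simp: M1_def le_nat_iff ceiling_le_iff)
    hence dM: "d * real M \<ge> 4" using d by (simp add: field_simps)
    define K where "K = nat \<lfloor>real M + d / 2 * real M\<rfloor>"
    have K: "real K \<le> real M + d / 2 * real M" "real K > real M + d / 2 * real M - 1"
      using d unfolding K_def by (auto simp: of_nat_nat) linarith+
    have MK: "M \<le> K" using K(2) dM by linarith
    have dMM: "d * real M \<le> real M" using d mult_right_mono[of d 1 "real M"] by simp
    have "T K - T M = (\<Sum>n=M..<K. (chebyshev_psi n - real n) * (1 / real n - 1 / real (Suc n)))"
      using sum.atLeastLessThan_concat[OF M_ge(2) MK, of "\<lambda>n. (chebyshev_psi n - real n) * (1 / real n - 1 / real (Suc n))"]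
      by (simp add: T_def algebra_simps)
    also have "\<dots> \<ge> (\<Sum>n=M..<K. (d / 2 * real M) * (1 / (4 * (real M)\<^sup>2)))"
    proof (intro sum_mono mult_mono)
      fix n assume n: "n \<in> {M..<K}"
      hence nK: "real n + 1 \<le> real K" by (simp add: Suc_le_eq)
      have "chebyshev_psi M \<le> chebyshev_psi n" using n by (intro chebyshev_psi_mono) auto
      thus *: "d / 2 * real M \<le> chebyshev_psi n - real n" using big nK K(1) by linarith
      show "0 \<le> chebyshev_psi n - real n" using * dM by linarith
      have n0: "real n > 0" using n M_ge by auto
      have "real n * (real n + 1) \<le> (2 * real M) * (2 * real M)"
        using nK K(1) dMM by (intro mult_mono) linarith+
      hence "1 / (4 * (real M)\<^sup>2) \<le> 1 / (real n * (real n + 1))"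
        using n0 M_ge by (intro divide_left_mono mult_pos_pos) (auto simp: power2_eq_square)
      also have "\<dots> = 1 / real n - 1 / real (Suc n)" using n0 by (simp add: field_simps)
      finally show "1 / (4 * (real M)\<^sup>2) \<le> 1 / real n - 1 / real (Suc n)" .
    qed auto
    also have "(\<Sum>n=M..<K. (d / 2 * real M) * (1 / (4 * (real M)\<^sup>2))) = (real K - real M) * (d / (8 * real M))"
      using M_ge MK by (simp add: of_nat_diff power2_eq_square)
    finally have "T K - T M \<ge> (real K - real M) * (d / (8 * real M))" .
    moreover have "(real K - real M) * (d / (8 * real M)) \<ge> (d * real M / 4) * (d / (8 * real M))"
      using K(2) dM d M_ge by (intro mult_right_mono) auto
    moreover have "(d * real M / 4) * (d / (8 * real M)) = d\<^sup>2 / 32"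
      using M_ge by (simp add: power2_eq_square)
    ultimately have "T K - T M \<ge> d\<^sup>2 / 32" by linarith
    moreover have "\<bar>T K - T M\<bar> < d\<^sup>2 / 32" using M0[of K M] MK M_ge by simp
    ultimately show False by linarith
  qed
  thus ?thesis unfolding eventually_sequentially by blast
qed

section \<open>GA1 numbers\<close>

text \<open>A divisor is either \<open>p\<close> times a divisor of \<open>p ^ k * m\<close>, or
  prime to \<open>p\<close> and then a divisor of \<open>m\<close>.\<close>

lemma divisor_sum_prime_step:
  assumes p: "prime p" and m: "m > 0" "\<not> p dvd m"
  shows "divisor_sum (p ^ Suc k * m) = p * divisor_sum (p ^ k * m) + divisor_sum m"
proof -
  have p0: "p > 0" using p prime_gt_0_nat by blast
  have "{d. d dvd p ^ Suc k * m} = (\<lambda>d. p * d) ` {d. d dvd p ^ k * m} \<union> {d. d dvd m}"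
  proof (intro equalityI subsetI)
    fix d assume d: "d \<in> {d. d dvd p ^ Suc k * m}"
    show "d \<in> (\<lambda>d. p * d) ` {d. d dvd p ^ k * m} \<union> {d. d dvd m}"
    proof (cases "p dvd d")
      case True
      then obtain c where "d = p * c" by auto
      thus ?thesis using d p0 by (auto simp: mult.assoc)
    next
      case False
      hence "coprime d (p ^ Suc k)" using p by (metis coprime_commute coprime_power_left_iff prime_imp_coprime)
      thus ?thesis using d by (simp add: coprime_dvd_mult_right_iff)
    qed
  qed (auto simp: mult.assoc)
  moreover have "(\<lambda>d. p * d) ` {d. d dvd p ^ k * m} \<inter> {d. d dvd m} = {}"
    using m(2) dvd_mult_left by fastforce
  ultimately have "divisor_sum (p ^ Suc k * m) = (\<Sum>d\<in>(\<lambda>d. p * d) ` {d. d dvd p ^ k * m}. d) + divisor_sum m"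
    unfolding divisor_sum_def using m(1) p0 by (simp add: sum.union_disjoint)
  also have "(\<Sum>d\<in>(\<lambda>d. p * d) ` {d. d dvd p ^ k * m}. d) = p * divisor_sum (p ^ k * m)"
    unfolding divisor_sum_def using p0
    by (subst sum.reindex) (auto simp: inj_on_def sum_distrib_left)
  finally show ?thesis .
qed

lemma divisor_sum_prime_power_ge:
  assumes "prime p" "m > 0" "\<not> p dvd m"
  shows "p ^ k * divisor_sum m \<le> divisor_sum (p ^ k * m)"
proof (induction k)
  case (Suc k)
  have "p ^ Suc k * divisor_sum m = p * (p ^ k * divisor_sum m)" by simp
  also have "\<dots> \<le> p * divisor_sum (p ^ k * m)" by (intro mult_le_mono2 Suc)
  also have "\<dots> \<le> divisor_sum (p ^ Suc k * m)"
    unfolding divisor_sum_prime_step[OF assms] by simp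
  finally show ?case .
qed simp

text \<open>Here \<open>\<Omega>(N) \<ge> 3\<close> enters: 3 is the least integer whose iterated
  logarithm is positive, and a number with two prime factors is neither 1 nor 2.\<close>

lemma big_omega_div_prime:
  assumes "prime p" "p dvd N" "N > 0" "big_omega N \<ge> 3"
  shows "N div p \<ge> 3"
proof -
  obtain q where q: "N = p * q" using assms by auto
  have q0: "q > 0" "p > 0" using assms(3) q by auto
  have "prime_factorization N = {#p#} + prime_factorization q"
    using q q0 assms(1) by (simp add: prime_factorization_mult prime_factorization_prime)
  hence "big_omega q \<ge> 2" using assms(4) by (simp add: big_omega_def)
  moreover have "big_omega 1 = 0" "big_omega 2 = 1"
    by (simp_all add: big_omega_def prime_factorization_prime)
  ultimately have "q \<noteq> 1" "q \<noteq> 2" by auto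
  hence "q \<ge> 3" using q0 by linarith
  thus ?thesis using q q0 by simp
qed

text \<open>With \<open>L\<close> and \<open>M\<close> the logarithms of \<open>N\<close> and
  \<open>N div p\<close>, the GA1 inequality bounds \<open>ln L / ln M\<close> by
  \<open>1 + s / (p * a)\<close>, and \<open>p ^ r * s \<le> p * a\<close> bounds this by
  \<open>1 + p^(-r)\<close>. Hence \<open>p ^ r * (ln L - ln M) \<le> ln L\<close>, where the
  difference is at least \<open>ln p / L\<close>.\<close>

lemma GA1_prime_power_bound:
  assumes N: "GA1 N" "big_omega N \<ge> 3" and p: "prime p" "p dvd N"
  shows "real p ^ multiplicity p N * ln (real p) \<le> ln (real N) * ln (ln (real N))"
proof -
  have N0: "N > 1" using N by (simp add: GA1_def)
  have q3: "N div p \<ge> 3" using big_omega_div_prime[OF p _ N(2)] N0 by simp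
  define r where "r = multiplicity p N"
  obtain m where m: "N = p ^ r * m" "\<not> p dvd m"
    using multiplicity_decompose'[of N p] N0 p(1) unfolding r_def
    by (metis not_prime_unit not_less0)
  have r: "r > 0" using p N0 by (simp add: r_def prime_multiplicity_gt_zero_iff)
  then obtain k where k: "r = Suc k" by (cases r) auto
  have m0: "m > 0" using m(1) N0 by (cases m) auto
  have p2: "p \<ge> 2" using p(1) by (rule prime_ge_2_nat)
  have q: "N div p = p ^ k * m" using m(1) k p2 by simp
  have Np: "real N = real p * real (N div p)"
    using p(2) by (metis dvd_mult_div_cancel of_nat_mult)
  define s where "s = real (divisor_sum m)"
  define a where "a = real (divisor_sum (N div p))"
  have \<sigma>N: "real (divisor_sum N) = real p * a + s"
    using divisor_sum_prime_step[OF p(1) m0 m(2), of k] m(1) k q by (simp add: a_def s_def)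
  have as: "real p ^ r * s \<le> real p * a"
  proof -
    have "real (p ^ k * divisor_sum m) \<le> real (divisor_sum (p ^ k * m))"
      using divisor_sum_prime_power_ge[OF p(1) m0 m(2)] by (simp only: of_nat_le_iff)
    hence "real p * (real p ^ k * s) \<le> real p * a"
      by (intro mult_left_mono) (simp_all add: a_def s_def q)
    thus ?thesis by (simp add: k mult.assoc)
  qed
  have s0: "s > 0"
  proof -
    have "1 \<le> divisor_sum m"
      unfolding divisor_sum_def using m0 by (intro order_trans[OF _ member_le_sum[of 1]]) auto
    thus ?thesis by (simp add: s_def)
  qed
  define L where "L = ln (real N)"
  define M where "M = ln (real (N div p))"
  have lp: "ln (real p) > 0" using p2 by simp
  have M: "M > 1"
  proof -
    have "ln 3 \<le> M" unfolding M_def using q3 by (subst ln_le_cancel_iff) auto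
    thus ?thesis using ln3_gt_1 by linarith
  qed
  have LM: "L = M + ln (real p)"
    unfolding L_def M_def Np using p2 q3 by (subst ln_mult) auto
  hence L: "L > 1" "M \<le> L" using M lp by auto
  have lM: "ln M > 0" "ln L > 0" using M L by auto
  have "gronwall (N div p) \<le> gronwall N" using N p by (auto simp: GA1_def)
  hence "a / (real (N div p) * ln M) \<le> (real p * a + s) / (real p * real (N div p) * ln L)"
    unfolding gronwall_def \<sigma>N a_def[symmetric] L_def[symmetric] M_def[symmetric] Np[symmetric] .
  hence "a * (real p * ln L) \<le> (real p * a + s) * ln M"
    using q3 p2 lM by (simp add: divide_simps mult_ac)
  hence "real p * a * (ln L - ln M) \<le> s * ln M" by (simp add: algebra_simps)
  moreover have "real p ^ r * s * (ln L - ln M) \<le> real p * a * (ln L - ln M)"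
    using as L M by (intro mult_right_mono) auto
  moreover have "s * ln M \<le> s * ln L" using s0 L M by (intro mult_left_mono) auto
  ultimately have "s * (real p ^ r * (ln L - ln M)) \<le> s * ln L" by (simp add: mult_ac)
  hence key: "real p ^ r * (ln L - ln M) \<le> ln L" using s0 by simp
  \<comment> \<open>This is \<open>- ln (1 - x) \<ge> x\<close> for
    \<open>x = ln p / L\<close>.\<close>
  have "ln (M / L) \<le> M / L - 1" using L M by (intro ln_le_minus_one) auto
  moreover have "ln (M / L) = ln M - ln L" using L M by (simp add: ln_div)
  moreover have "M / L = 1 - ln (real p) / L"
  proof -
    have "M = L - ln (real p)" using LM by simp
    thus ?thesis using L by (simp add: diff_divide_distrib)
  qed
  ultimately have "ln (real p) / L \<le> ln L - ln M" by linarith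
  hence "real p ^ r * (ln (real p) / L) \<le> real p ^ r * (ln L - ln M)"
    by (intro mult_left_mono) auto
  with key have "real p ^ r * (ln (real p) / L) \<le> ln L" by linarith
  hence "real p ^ r * ln (real p) \<le> L * ln L"
    using L by (simp add: field_simps)
  thus ?thesis unfolding r_def L_def .
qed

lemma GA1_ln_gt_1:
  assumes N: "GA1 N" "big_omega N \<ge> 3"
  shows "ln (real N) > 1"
proof -
  have N0: "N > 1" using N by (simp add: GA1_def)
  then obtain p where p: "prime p" "p dvd N" using prime_factor_nat[of N] by auto
  have "N \<ge> 3" using big_omega_div_prime[OF p _ N(2)] N0 div_le_dividend[of N p] by linarith
  hence "ln 3 \<le> ln (real N)" by (subst ln_le_cancel_iff) auto
  thus ?thesis using ln3_gt_1 by linarith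
qed

section \<open>Comparison of the largest prime factor with \<open>ln N\<close>\<close>

lemma largest_prime_factor_props:
  assumes "N > 1"
  shows "prime (largest_prime_factor N)" "largest_prime_factor N dvd N"
    "\<And>p. prime p \<Longrightarrow> p dvd N \<Longrightarrow> p \<le> largest_prime_factor N"
proof -
  obtain p where "prime p" "p dvd N" using assms prime_factor_nat[of N] by auto
  hence "p \<in> prime_factors N" using assms by (simp add: in_prime_factors_iff)
  hence "prime_factors N \<noteq> {}" by blast
  hence "largest_prime_factor N \<in> prime_factors N"
    unfolding largest_prime_factor_def by (intro Max_in) auto
  thus "prime (largest_prime_factor N)" "largest_prime_factor N dvd N" by auto
  show "\<And>p. prime p \<Longrightarrow> p dvd N \<Longrightarrow> p \<le> largest_prime_factor N"
    unfolding largest_prime_factor_def using assms by (intro Max_ge) (auto simp: in_prime_factors_iff)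
qed

lemma GA1_largest_prime_factor_le:
  assumes N: "GA1 N" "big_omega N \<ge> 3"
  shows "real (largest_prime_factor N) \<le> ln (real N)"
proof -
  have N0: "N > 1" using N by (simp add: GA1_def)
  define P L where "P = real (largest_prime_factor N)" and "L = ln (real N)"
  have L: "L > 1" using GA1_ln_gt_1[OF N] by (simp add: L_def)
  note pf = largest_prime_factor_props[OF N0]
  have P2: "P \<ge> 2" using prime_ge_2_nat[OF pf(1)] by (simp add: P_def)
  have "multiplicity (largest_prime_factor N) N \<ge> 1"
    using pf(1,2) N0 by (simp add: prime_multiplicity_gt_zero_iff Suc_le_eq)
  hence "P ^ 1 \<le> P ^ multiplicity (largest_prime_factor N) N"
    using P2 by (intro power_increasing) auto
  hence "P * ln P \<le> P ^ multiplicity (largest_prime_factor N) N * ln P"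
    using P2 by (intro mult_right_mono) auto
  also have "\<dots> \<le> L * ln L"
    unfolding P_def L_def by (rule GA1_prime_power_bound[OF N pf(1,2)])
  finally have le: "P * ln P \<le> L * ln L" .
  have "P \<le> L"
  proof (rule ccontr)
    assume "\<not> P \<le> L"
    hence "L * ln L < P * ln P" using L by (intro mult_strict_mono) auto
    with le show False by simp
  qed
  thus ?thesis by (simp add: P_def L_def)
qed

text \<open>Counted once each, the primes of \<open>N\<close> are covered by
  \<open>chebyshev_psi\<close>. A prime of exponent at least 2 has \<open>p^2 \<le> Y\<close>, so
  there are at most \<open>sqrt Y\<close> of them, and each prime power contributes at most
  \<open>ln Y\<close>.\<close>

lemma ln_le_psi_largest_prime_factor:
  fixes Y :: real
  assumes N0: "N > 1" and Y: "\<And>p. prime p \<Longrightarrow> p dvd N \<Longrightarrow> real p ^ multiplicity p N \<le> Y"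
  shows "ln (real N) \<le> chebyshev_psi (largest_prime_factor N) + sqrt Y * ln Y"
proof -
  note pf = largest_prime_factor_props[OF N0]
  have fin: "finite (prime_factors N)" by simp
  have Y1: "Y \<ge> 1"
    using Y[OF pf(1,2)] prime_ge_1_nat[OF pf(1)] one_le_power[of "real (largest_prime_factor N)"]
    by (meson of_nat_1 of_nat_mono order_trans one_le_power real_of_nat_ge_one_iff)
  define B where "B = {p \<in> prime_factors N. multiplicity p N \<ge> 2}"
  have "real N = (\<Prod>p\<in>prime_factors N. real p ^ multiplicity p N)"
    using N0 by (subst prime_factorization_nat[of N]) (simp_all add: of_nat_prod)
  hence "ln (real N) = (\<Sum>p\<in>prime_factors N. ln (real p ^ multiplicity p N))"
    by (simp only:) (rule ln_prod, auto dest!: in_prime_factors_imp_prime prime_gt_0_nat)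
  \<comment> \<open>A repeated prime is charged \<open>ln Y\<close> in addition to
    \<open>ln p\<close>, so that the first part runs over all primes of \<open>N\<close>.\<close>
  also have "\<dots> \<le> (\<Sum>p\<in>prime_factors N. ln (real p) + (if multiplicity p N \<ge> 2 then ln Y else 0))"
  proof (rule sum_mono)
    fix p assume "p \<in> prime_factors N"
    hence p: "prime p" "p dvd N" by auto
    have p1: "real p \<ge> 1" using prime_ge_1_nat[OF p(1)] by simp
    have pos: "multiplicity p N > 0" using p N0 by (simp add: prime_multiplicity_gt_zero_iff)
    show "ln (real p ^ multiplicity p N) \<le> ln (real p) + (if multiplicity p N \<ge> 2 then ln Y else 0)"
    proof (cases "multiplicity p N \<ge> 2")
      case True
      have "ln (real p ^ multiplicity p N) \<le> ln Y"
        using Y[OF p] p1 Y1 by (subst ln_le_cancel_iff) auto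
      thus ?thesis using True p1 by (simp add: ln_ge_zero add_increasing)
    next
      case False
      hence "multiplicity p N = 1" using pos by linarith
      thus ?thesis by simp
    qed
  qed
  also have "\<dots> = (\<Sum>p\<in>prime_factors N. ln (real p)) + real (card B) * ln Y"
    by (simp add: sum.distrib B_def sum.If_cases Int_def)
  also have "(\<Sum>p\<in>prime_factors N. ln (real p)) = (\<Sum>p\<in>prime_factors N. mangoldt p)"
    by (intro sum.cong) (auto dest!: in_prime_factors_imp_prime)
  also have "\<dots> \<le> chebyshev_psi (largest_prime_factor N)"
    unfolding chebyshev_psi_def
  proof (intro sum_mono2 mangoldt_nonneg subsetI)
    fix p assume "p \<in> prime_factors N"
    hence "prime p" "p dvd N" by auto
    thus "p \<in> {1..largest_prime_factor N}" using pf(3) prime_ge_1_nat by auto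
  qed simp
  also have "real (card B) \<le> sqrt Y"
  proof -
    have "B \<subseteq> {1..nat \<lfloor>sqrt Y\<rfloor>}"
    proof
      fix p assume p: "p \<in> B"
      hence pp: "prime p" "p dvd N" "multiplicity p N \<ge> 2" by (auto simp: B_def)
      have p1: "real p \<ge> 1" using prime_ge_1_nat[OF pp(1)] by simp
      have "real p ^ 2 \<le> real p ^ multiplicity p N" by (rule power_increasing[OF pp(3) p1])
      also have "\<dots> \<le> Y" by (rule Y[OF pp(1,2)])
      finally have "real p \<le> sqrt Y" by (rule real_le_rsqrt)
      thus "p \<in> {1..nat \<lfloor>sqrt Y\<rfloor>}" using p1 by (auto simp: le_nat_floor)
    qed
    hence "card B \<le> nat \<lfloor>sqrt Y\<rfloor>" using card_mono[of "{1..nat \<lfloor>sqrt Y\<rfloor>}" B] by simp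
    moreover have "real (nat \<lfloor>sqrt Y\<rfloor>) \<le> sqrt Y" using Y1 by (simp add: of_nat_floor)
    ultimately show ?thesis by linarith
  qed
  finally show ?thesis using Y1 by (simp add: mult_right_mono)
qed

theorem theorem13:
  shows "((\<lambda>N. real (largest_prime_factor N) / ln (real N)) \<longlongrightarrow> 1)
           (inf at_top (principal {N. GA1 N \<and> big_omega N \<ge> 3}))"
proof (rule order_tendstoI)
  fix a :: real assume "a > 1"
  have "real (largest_prime_factor N) / ln (real N) < a" if "GA1 N" "big_omega N \<ge> 3" for N
  proof -
    have "real (largest_prime_factor N) / ln (real N) \<le> 1"
      using GA1_largest_prime_factor_le[OF that] GA1_ln_gt_1[OF that] by simp
    with \<open>a > 1\<close> show ?thesis by linarith
  qed
  thus "\<forall>\<^sub>F N in inf at_top (principal {N. GA1 N \<and> big_omega N \<ge> 3}).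
      real (largest_prime_factor N) / ln (real N) < a"
    unfolding eventually_inf_principal by (intro always_eventually) auto
next
  fix a :: real assume a: "a < 1"
  define b where "b = max a 0"
  have b: "0 \<le> b" "b < 1" "a \<le> b" using a by (auto simp: b_def)
  \<comment> \<open>Then \<open>b * (1 + d) \<le> b + d\<close>, which is below \<open>1 - d\<close>
    because \<open>1 - b = 4 * d\<close> exceeds \<open>2 * d\<close>.\<close>
  define d where "d = (1 - b) / 4"
  have d: "d > 0" "d \<le> 1 / 4" using b by (auto simp: d_def)
  have bd: "b * (1 + d) < 1 - d"
  proof -
    have "d * b \<le> d * 1" using b d by (intro mult_left_mono) auto
    moreover have "4 * d = 1 - b" by (simp add: d_def)
    moreover have "b * (1 + d) = b + d * b" by (simp add: algebra_simps)
    ultimately show ?thesis using d by linarith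
  qed
  \<comment> \<open>The prime power bound with \<open>ln p\<close> replaced by its least value
    \<open>ln 2\<close>.\<close>
  define Y :: "real \<Rightarrow> real" where "Y = (\<lambda>L. L * ln L / ln 2)"
  have lnN: "filterlim (\<lambda>N::nat. ln (real N)) at_top at_top" by real_asymp
  have "((\<lambda>L. sqrt (Y L) * ln (Y L) / L) \<longlongrightarrow> 0) at_top"
    unfolding Y_def by real_asymp
  hence "\<forall>\<^sub>F L in at_top. sqrt (Y L) * ln (Y L) / L < d" by (rule order_tendstoD(2)) (rule d(1))
  hence ev1: "\<forall>\<^sub>F N::nat in at_top. sqrt (Y (ln (real N))) * ln (Y (ln (real N))) / ln (real N) < d"
    by (rule eventually_compose_filterlim[OF _ lnN])
  obtain n0 where n0: "\<And>n. n \<ge> n0 \<Longrightarrow> chebyshev_psi n \<le> (1 + d) * real n"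
    using chebyshev_psi_limsup[OF d(1)] unfolding eventually_sequentially by blast
  \<comment> \<open>Since \<open>chebyshev_psi P \<le> 4 * P\<close> and
    \<open>(1 - d) * L \<ge> L / 2\<close>, it will follow that \<open>P \<ge> L / 8\<close>; the
    factor 8 thus brings \<open>P\<close> into the range of the sharp bound.\<close>
  have "\<forall>\<^sub>F L in at_top. L \<ge> 8 * real n0" by (rule eventually_ge_at_top)
  hence ev2: "\<forall>\<^sub>F N::nat in at_top. ln (real N) \<ge> 8 * real n0"
    by (rule eventually_compose_filterlim[OF _ lnN])
  show "\<forall>\<^sub>F N in inf at_top (principal {N. GA1 N \<and> big_omega N \<ge> 3}).
      a < real (largest_prime_factor N) / ln (real N)"
    unfolding eventually_inf_principal using ev1 ev2
  proof eventually_elim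
    case (elim N)
    show ?case
    proof
      assume "N \<in> {N. GA1 N \<and> big_omega N \<ge> 3}"
      hence N: "GA1 N" "big_omega N \<ge> 3" by auto
      have N0: "N > 1" using N by (simp add: GA1_def)
      define P L where "P = largest_prime_factor N" and "L = ln (real N)"
      have L: "L > 1" using GA1_ln_gt_1[OF N] by (simp add: L_def)
      have "real p ^ multiplicity p N \<le> Y L" if p: "prime p" "p dvd N" for p
      proof -
        have "ln 2 \<le> ln (real p)" using prime_ge_2_nat[OF p(1)] by (subst ln_le_cancel_iff) auto
        hence "real p ^ multiplicity p N * ln 2 \<le> real p ^ multiplicity p N * ln (real p)"
          by (intro mult_left_mono) auto
        also have "\<dots> \<le> L * ln L" unfolding L_def by (rule GA1_prime_power_bound[OF N p])
        finally show ?thesis by (simp add: Y_def field_simps)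
      qed
      from ln_le_psi_largest_prime_factor[OF N0 this]
      have "L \<le> chebyshev_psi P + sqrt (Y L) * ln (Y L)" by (simp add: L_def P_def)
      moreover have "sqrt (Y L) * ln (Y L) < d * L" using elim(1) L by (simp add: L_def field_simps)
      ultimately have psi: "(1 - d) * L \<le> chebyshev_psi P" by (simp add: algebra_simps)
      have "1 / 2 * L \<le> (1 - d) * L" using d L by (intro mult_right_mono) auto
      hence "1 / 2 * L \<le> 4 * real P" using psi chebyshev_psi_le[of P] by linarith
      hence "P \<ge> n0" using elim(2) by (simp add: L_def)
      hence "(1 - d) * L \<le> (1 + d) * real P" using psi n0[of P] by linarith
      moreover have "b * (1 + d) * L < (1 - d) * L" using bd L by simp
      ultimately have "(1 + d) * (b * L) < (1 + d) * real P" by (simp add: mult_ac)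
      hence "b * L < real P" using d by simp
      hence "b < real P / L" using L by (simp add: field_simps)
      thus "a < real (largest_prime_factor N) / ln (real N)" using b by (simp add: P_def L_def)
    qed
  qed
qed

end
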